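(* Let $(W,\sigma)$ be a symplectic vector space and $T:W\to W$ a linear map such that $T+T^{\sigma}$ is an isomorphism. Then any two irreducible $\omega_{\sigma,T}$-representations of $W$ are unitarily equivalent.
   Context: A symplectic vector space $(W,\sigma)$ is a finite-dimensional real vector space $W$ with a non-degenerate antisymmetric bilinear form $\sigma$. The symplectic adjoint $T^{\sigma}$ of a linear map $T:W\to W$ is defined by $\sigma(T^{\sigma}\xi,\eta)=\sigma(\xi,T\eta)$ for all $\xi,\eta$. Put $\omega_{\sigma,T}(\xi,\eta)=\mathrm{e}^{\mathrm{i}\sigma(\xi,T\eta)}$. An $\omega_{\sigma,T}$-representation of $W$ is a complex Hilbert space $\mathcal{H}$ together with a strongly continuous map $\mathcal{W}:W\to\mathcal{U}(\mathcal{H})$ into the unitary operators such that $\mathcal{W}(\xi)\mathcal{W}(\eta)=\omega_{\sigma,T}(\xi,\eta)\mathcal{W}(\xi+\eta)$ for all $\xi,\eta\in W$. It is irreducible if $\mathcal{H}\neq 0$ and the only closed subspaces invariant under all $\mathcal{W}(\xi)$ are $0$ and $\mathcal{H}$. Two such representations $(\mathcal{H}_1,\mathcal{W}_1)$, $(\mathcal{H}_2,\mathcal{W}_2)$ are unitarily equivalent if there is a unitary $U:\mathcal{H}_1\to\mathcal{H}_2$ with $U\mathcal{W}_1(\xi)=\mathcal{W}_2(\xi)U$ for all $\xi\in W$. *)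

theory Defs
  imports "HOL-Analysis.Analysis"
begin

text \<open>The inner product is linear in the second argument. Real scaling and the norm, which
  \<^class>\<open>banach\<close> provides, are tied to the complex structure and the inner product.\<close>

class complex_hilbert = banach +
  fixes scaleC :: "complex \<Rightarrow> 'a \<Rightarrow> 'a" (infixr \<open>*\<^sub>C\<close> 75)
    and cinner :: "'a \<Rightarrow> 'a \<Rightarrow> complex"
  assumes scaleC_add_right: "a *\<^sub>C (x + y) = a *\<^sub>C x + a *\<^sub>C y"
    and scaleC_add_left: "(a + b) *\<^sub>C x = a *\<^sub>C x + b *\<^sub>C x"
    and scaleC_scaleC: "a *\<^sub>C b *\<^sub>C x = (a * b) *\<^sub>C x"
    and scaleC_of_real: "complex_of_real r *\<^sub>C x = r *\<^sub>R x"
    and cinner_commute: "cinner x y = cnj (cinner y x)"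
    and cinner_add_right: "cinner x (y + z) = cinner x y + cinner x z"
    and cinner_scaleC_right: "cinner x (a *\<^sub>C y) = a * cinner x y"
    and cinner_self: "cinner x x = complex_of_real ((norm x)\<^sup>2)"

lemma vector_space_scaleC: "vector_space (scaleC :: complex \<Rightarrow> 'a \<Rightarrow> 'a::complex_hilbert)"
proof
  fix x :: 'a
  show "1 *\<^sub>C x = x" using scaleC_of_real[of 1 x] by simp
qed (simp_all add: scaleC_add_right scaleC_add_left scaleC_scaleC)

abbreviation csubspace :: "'h::complex_hilbert set \<Rightarrow> bool" where
  "csubspace \<equiv> module.subspace scaleC"

abbreviation clinear :: "('g::complex_hilbert \<Rightarrow> 'h::complex_hilbert) \<Rightarrow> bool" where
  "clinear \<equiv> Vector_Spaces.linear scaleC scaleC"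

definition unitary :: "('g::complex_hilbert \<Rightarrow> 'h::complex_hilbert) \<Rightarrow> bool" where
  "unitary U \<longleftrightarrow> clinear U \<and> bij U \<and> (\<forall>x y. cinner (U x) (U y) = cinner x y)"

instantiation complex :: complex_hilbert
begin
definition scaleC_complex :: "complex \<Rightarrow> complex \<Rightarrow> complex" where "scaleC_complex a x = a * x"
definition cinner_complex :: "complex \<Rightarrow> complex \<Rightarrow> complex" where "cinner_complex x y = cnj x * y"
instance
  by standard
    (simp_all add: scaleC_complex_def cinner_complex_def algebra_simps scaleR_conv_of_real
      complex_norm_square del: of_real_power)
end

definition symplectic :: "('w::real_vector \<Rightarrow> 'w \<Rightarrow> real) \<Rightarrow> bool" where
  "symplectic \<sigma> \<longleftrightarrow>
     (\<exists>B :: 'w set. finite B \<and> span B = UNIV) \<and>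
     bilinear \<sigma> \<and>
     (\<forall>\<xi> \<eta>. \<sigma> \<xi> \<eta> = - \<sigma> \<eta> \<xi>) \<and>
     (\<forall>\<xi>. (\<forall>\<eta>. \<sigma> \<xi> \<eta> = 0) \<longrightarrow> \<xi> = 0)"

definition symplectic_adjoint ::
    "('w::real_vector \<Rightarrow> 'w \<Rightarrow> real) \<Rightarrow> ('w \<Rightarrow> 'w) \<Rightarrow> 'w \<Rightarrow> 'w" where
  "symplectic_adjoint \<sigma> T = (THE S. \<forall>\<xi> \<eta>. \<sigma> (S \<xi>) \<eta> = \<sigma> \<xi> (T \<eta>))"

lemma symplectic_adjoint_works:
  fixes \<sigma> :: "'w::real_vector \<Rightarrow> 'w \<Rightarrow> real"
  assumes \<sigma>: "symplectic \<sigma>" and T: "linear T"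
  shows "\<sigma> (symplectic_adjoint \<sigma> T \<xi>) \<eta> = \<sigma> \<xi> (T \<eta>)"
proof -
  from \<sigma> obtain B0 :: "'w set" where B0: "finite B0" "span B0 = UNIV"
    unfolding symplectic_def by blast
  obtain B where B: "B \<subseteq> B0" "independent B" "B0 \<subseteq> span B"
    by (rule maximal_independent_subset[of B0])
  have fB: "finite B" using B(1) B0(1) finite_subset by blast
  have sB: "span B = UNIV" using B(3) B0(2) span_mono[OF B(3)] by (auto simp: span_span)
  have fd: "finite_dimensional_vector_space (scaleR :: real \<Rightarrow> 'w \<Rightarrow> 'w) B"
    using fB sB B(2) unfolding span_raw_def dependent_raw_def
    by (intro finite_dimensional_vector_space.intro finite_dimensional_vector_space_axioms.intro
        real_vector.vector_space_axioms)
  have l1: "linear (\<sigma> x)" and l2: "linear (\<lambda>x. \<sigma> x y)" for x y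
    using \<sigma> unfolding symplectic_def bilinear_def by blast+
  have nondeg: "x = 0" if "\<And>y. \<sigma> x y = 0" for x
    using \<sigma> that unfolding symplectic_def by blast
  have eq_on: "f = g" if "linear f" "linear g" "\<And>b. b \<in> B \<Longrightarrow> f b = g b"
    for f g :: "'w \<Rightarrow> real"
    using linear_eq_on_span[OF that(1,2), of B] that(3) sB by auto
  define \<Phi> where "\<Phi> x = (\<Sum>b\<in>B. \<sigma> x b *\<^sub>R b)" for x
  have lin: "linear \<Phi>"
    unfolding \<Phi>_def
    by (intro linearI) (simp_all add: linear_add[OF l2] linear_scale[OF l2]
        scaleR_add_left sum.distrib scaleR_sum_right)
  have coeff: "c b = 0" if "(\<Sum>b\<in>B. c b *\<^sub>R b) = 0" "b \<in> B" for c b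
    by (rule independentD[OF B(2) fB subset_refl that])
  have inj: "inj \<Phi>"
  proof (subst linear_injective_0[OF lin], intro allI impI)
    fix x assume "\<Phi> x = 0"
    then have "\<sigma> x b = 0" if "b \<in> B" for b using coeff[of "\<sigma> x", OF _ that] by (simp add: \<Phi>_def)
    then have "\<sigma> x = (\<lambda>_. 0)" by (intro eq_on l1) (auto intro: linear_zero)
    then show "x = 0" by (intro nondeg) simp
  qed
  have surj: "surj \<Phi>"
    using finite_dimensional_vector_space.linear_inj_imp_surj[OF fd lin[unfolded linear_def] inj] .
  have riesz: "\<exists>z. \<forall>y. \<sigma> z y = f y" if f: "linear f" for f :: "'w \<Rightarrow> real"
  proof -
    obtain z where z: "\<Phi> z = (\<Sum>b\<in>B. f b *\<^sub>R b)" using surj by (metis surjD)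
    have "(\<Sum>b\<in>B. (\<sigma> z b - f b) *\<^sub>R b) = 0"
      using z by (simp add: \<Phi>_def scaleR_diff_left sum_subtractf)
    then have "\<sigma> z b = f b" if "b \<in> B" for b using coeff[of "\<lambda>b. \<sigma> z b - f b" b] that by simp
    then have "\<sigma> z = f" by (intro eq_on l1 f)
    then show ?thesis by auto
  qed
  have "\<exists>z. \<forall>y. \<sigma> z y = \<sigma> x (T y)" for x
    using riesz[OF linear_compose[OF T l1[of x]]] by (simp add: o_def)
  then obtain S where S: "\<forall>x y. \<sigma> (S x) y = \<sigma> x (T y)" by metis
  have uniq: "S' = S" if S': "\<forall>x y. \<sigma> (S' x) y = \<sigma> x (T y)" for S'
  proof
    fix x
    have "\<sigma> (S' x - S x) y = 0" for y using S S' linear_diff[OF l2, of "S' x" "S x" y] by simp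
    then show "S' x = S x" using nondeg[of "S' x - S x"] by simp
  qed
  have "\<forall>x y. \<sigma> (symplectic_adjoint \<sigma> T x) y = \<sigma> x (T y)"
    unfolding symplectic_adjoint_def
    by (rule theI[where P = "\<lambda>S. \<forall>x y. \<sigma> (S x) y = \<sigma> x (T y)", OF S uniq])
  then show ?thesis by blast
qed

text \<open>The canonical topology of a finite-dimensional real vector space, i.e. its only
  Hausdorff vector space topology, is the coarsest one making all linear functionals continuous.\<close>

definition linear_topology :: "'w::real_vector topology" where
  "linear_topology = topology_generated_by {f -` U | (f :: 'w \<Rightarrow> real) U. linear f \<and> open U}"

lemma linear_topology_eq_euclidean:
  "(linear_topology :: 'a::euclidean_space topology) = euclidean"
proof (rule topology_eq[THEN iffD2], intro allI iffI)
  let ?S = "{f -` U | (f :: 'a \<Rightarrow> real) U. linear f \<and> open U}"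
  fix V :: "'a set"
  { assume "openin linear_topology V"
    then have "generate_topology_on ?S V"
      by (simp add: linear_topology_def openin_topology_generated_by_iff)
    then show "openin euclidean V"
    proof induction
      case (Basis s)
      then show ?case
        by (auto intro!: open_vimage linear_continuous_on simp: linear_linear)
    qed auto }
  { assume "openin euclidean V"
    then have V: "open V" by simp
    show "openin linear_topology V"
    proof (subst openin_subopen, intro ballI)
      fix x assume "x \<in> V"
      with V obtain a b where ab: "box a b \<subseteq> V" and x: "x \<in> box a b"
        by (rule open_contains_box)
      have "openin linear_topology ((\<lambda>y. y \<bullet> i) -` {a \<bullet> i<..<b \<bullet> i})" for i :: 'a
        unfolding linear_topology_def
        proof (rule topology_generated_by_Basis, rule CollectI, intro exI conjI)
        show "linear (\<lambda>y. y \<bullet> i)" by (rule bounded_linear.linear[OF bounded_linear_inner_left])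
      qed (rule refl open_greaterThanLessThan)+
      then have "openin linear_topology (\<Inter>i\<in>Basis. (\<lambda>y::'a. y \<bullet> i) -` {a \<bullet> i<..<b \<bullet> i})"
        by (intro openin_INT2) auto
      moreover have "(\<Inter>i\<in>Basis. (\<lambda>y::'a. y \<bullet> i) -` {a \<bullet> i<..<b \<bullet> i}) = box a b"
        by (auto simp: box_def)
      ultimately show "\<exists>T. openin linear_topology T \<and> x \<in> T \<and> T \<subseteq> V" using x ab by auto
    qed }
qed

definition twist :: "('w \<Rightarrow> 'w \<Rightarrow> real) \<Rightarrow> ('w \<Rightarrow> 'w) \<Rightarrow> 'w \<Rightarrow> 'w \<Rightarrow> complex" where
  "twist \<sigma> T \<xi> \<eta> = exp (\<i> * complex_of_real (\<sigma> \<xi> (T \<eta>)))"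

definition twisted_representation ::
    "('w::real_vector \<Rightarrow> 'w \<Rightarrow> real) \<Rightarrow> ('w \<Rightarrow> 'w) \<Rightarrow> ('w \<Rightarrow> 'h::complex_hilbert \<Rightarrow> 'h) \<Rightarrow> bool" where
  "twisted_representation \<sigma> T W \<longleftrightarrow>
     (\<forall>\<xi>. unitary (W \<xi>)) \<and>
     (\<forall>x. continuous_map linear_topology euclidean (\<lambda>\<xi>. W \<xi> x)) \<and>
     (\<forall>\<xi> \<eta> x. W \<xi> (W \<eta> x) = twist \<sigma> T \<xi> \<eta> *\<^sub>C W (\<xi> + \<eta>) x)"

definition irreducible_representation :: "('w \<Rightarrow> 'h::complex_hilbert \<Rightarrow> 'h) \<Rightarrow> bool" where
  "irreducible_representation W \<longleftrightarrow>
     (UNIV :: 'h set) \<noteq> {0} \<and>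
     (\<forall>M. closed M \<and> csubspace M \<and> (\<forall>\<xi>. W \<xi> ` M \<subseteq> M) \<longrightarrow> M = {0} \<or> M = UNIV)"

definition unitarily_equivalent ::
    "('w \<Rightarrow> 'g::complex_hilbert \<Rightarrow> 'g) \<Rightarrow> ('w \<Rightarrow> 'h::complex_hilbert \<Rightarrow> 'h) \<Rightarrow> bool" where
  "unitarily_equivalent W\<^sub>1 W\<^sub>2 \<longleftrightarrow>
     (\<exists>U. unitary U \<and> (\<forall>\<xi> x. U (W\<^sub>1 \<xi> x) = W\<^sub>2 \<xi> (U x)))"

end

theory Submission
  imports Defs "HOL-Probability.Distributions" "HOL-Real_Asymp.Real_Asymp"
begin

text \<open>Multiplying by the phase exp(i \<sigma>(\<xi>, T \<xi>)/2) turns a representation into a Weyl system V for the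
  form \<omega>(\<xi>, \<eta>) = \<sigma>(\<xi>, T \<eta>) - \<sigma>(\<eta>, T \<xi>) = \<sigma>((T + S) \<xi>, \<eta>), S the symplectic adjoint of T, which
  is nondegenerate because T + S is bijective. By a GNS argument an irreducible representation is
  determined by the matrix coefficient of one nonzero vector, so it suffices to find in every
  representation a unit vector (the vacuum) with one and the same Gaussian coefficient.

  Following von Neumann, on a hyperbolic plane, identified with the complex numbers, let P be the
  integral of V(z) against exp(-|z|^2/4). Shifting the integration variable shows that
  exp(|a|^2/4) \<langle>y, V(a) P x\<rangle> is an entire function of the conjugate of a. If y lies in the range of
  P as well, then by symmetry it is also an entire function of a, hence constant: this replaces the
  usual evaluation of P V(a) P by double Gaussian integrals. Moreover P V(b) x = 0 for all b would make
  the Fourier transform of exp(-|z|^2/4) \<langle>x, V(z) x\<rangle> vanish, whence x = 0. The operators P for the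
  planes of a Darboux basis commute with each other, and their product yields the vacuum.\<close>

subsection \<open>Gaussian integrals\<close>

lemma integrable_gaussian_real:
  fixes c :: real
  assumes "c > 0"
  shows "integrable lborel (\<lambda>x::real. exp (- c * x\<^sup>2))"
proof -
  \<comment> \<open>The standard deviation for which the normal density is a multiple of exp (- c
    x^2).\<close>
  define d where "d = 1 / sqrt (2 * c)"
  have d: "d > 0" "d\<^sup>2 = 1 / (2 * c)"
    using assms by (auto simp: d_def power_divide)
  have "integrable lborel (\<lambda>x. sqrt (2 * pi * d\<^sup>2) * normal_density 0 d x)"
    using d by (intro integrable_mult_right integrable_normal_density) auto
  also have "(\<lambda>x. sqrt (2 * pi * d\<^sup>2) * normal_density 0 d x) = (\<lambda>x. exp (- c * x\<^sup>2))"
    using d assms by (auto simp: normal_density_def fun_eq_iff field_simps)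
  finally show ?thesis .
qed

text \<open>The Gaussian factorises over the coordinates, so its nonnegative integral is a power of
  the one-dimensional one.\<close>

lemma integrable_gaussian:
  fixes c :: real
  assumes "c > 0"
  shows "integrable lborel (\<lambda>x::'a::euclidean_space. exp (- c * (norm x)\<^sup>2))"
proof (rule integrableI_bounded)
  have fin: "(\<integral>\<^sup>+x. ennreal (exp (- c * x\<^sup>2)) \<partial>lborel) < \<infinity>"
    using integrableD(2)[OF integrable_gaussian_real[OF assms]] by (simp add: less_top)
  have "ennreal (exp (- c * (norm x)\<^sup>2)) = (\<Prod>b\<in>Basis. ennreal (exp (- c * (x \<bullet> b)\<^sup>2)))" for x :: 'a
  proof -
    have "(norm x)\<^sup>2 = (\<Sum>b\<in>Basis. (x \<bullet> b)\<^sup>2)"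
      by (subst power2_norm_eq_inner, subst euclidean_inner) (simp add: power2_eq_square)
    then show ?thesis
      by (subst prod_ennreal) (auto simp: exp_sum[symmetric] sum_distrib_left sum_negf)
  qed
  then have "(\<integral>\<^sup>+x. ennreal (norm (exp (- c * (norm (x::'a))\<^sup>2))) \<partial>lborel) =
      (\<integral>\<^sup>+x. (\<Prod>b\<in>Basis. ennreal (exp (- c * (x \<bullet> b)\<^sup>2))) \<partial>(lborel::'a measure))"
    by simp
  also have "\<dots> = (\<Prod>b\<in>(Basis::'a set). \<integral>\<^sup>+x. ennreal (exp (- c * x\<^sup>2)) \<partial>lborel)"
    by (rule nn_integral_lborel_prod) auto
  also have "\<dots> < \<infinity>"
    using fin by (simp add: power_less_top_ennreal)
  finally show "(\<integral>\<^sup>+x. ennreal (norm (exp (- c * (norm (x::'a))\<^sup>2))) \<partial>lborel) < \<infinity>" .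
qed auto

text \<open>Half of the decay exp (- r^2/4) is given up: completing a square absorbs
  \<open>exp (k * r)\<close>, the bound r^2 <= 16 exp (r^2/16) absorbs the polynomial factor, and
  exp (- r^2/8) remains.\<close>

lemma gaussian_dominates:
  fixes r k :: real
  assumes "r \<ge> 0"
  shows "r\<^sup>2 * exp (k * r) * exp (- r\<^sup>2 / 4) \<le> 16 * exp (4 * k\<^sup>2) * exp (- (1/8) * r\<^sup>2)"
    and "exp (k * r) * exp (- r\<^sup>2 / 4) \<le> exp (2 * k\<^sup>2) * exp (- (1/8) * r\<^sup>2)"
proof -
  have "r\<^sup>2 / 16 \<le> exp (r\<^sup>2 / 16)"
    using exp_ge_add_one_self[of "r\<^sup>2 / 16"] by linarith
  moreover have "k * r \<le> r\<^sup>2 / 16 + 4 * k\<^sup>2"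
    using sum_squares_ge_zero[of "r / 4 - 2 * k" 0] by (simp add: power2_eq_square algebra_simps)
  ultimately have "r\<^sup>2 * exp (k * r) * exp (- r\<^sup>2 / 4)
      \<le> (16 * exp (r\<^sup>2 / 16)) * exp (r\<^sup>2 / 16 + 4 * k\<^sup>2) * exp (- r\<^sup>2 / 4)"
    by (intro mult_mono) auto
  also have "\<dots> = 16 * exp (4 * k\<^sup>2) * exp (- (1/8) * r\<^sup>2)"
    by (simp add: mult_exp_exp mult.assoc)
  finally show "r\<^sup>2 * exp (k * r) * exp (- r\<^sup>2 / 4) \<le> 16 * exp (4 * k\<^sup>2) * exp (- (1/8) * r\<^sup>2)" .
  have "k * r \<le> r\<^sup>2 / 8 + 2 * k\<^sup>2"
    using sum_squares_ge_zero[of "r / 4 - k" 0] by (simp add: power2_eq_square algebra_simps)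
  then have "k * r + - r\<^sup>2 / 4 \<le> 2 * k\<^sup>2 + - (1/8) * r\<^sup>2"
    by linarith
  then show "exp (k * r) * exp (- r\<^sup>2 / 4) \<le> exp (2 * k\<^sup>2) * exp (- (1/8) * r\<^sup>2)"
    unfolding exp_add[symmetric] by simp
qed

definition gauss :: "complex \<Rightarrow> real" where
  "gauss z = exp (- (cmod z)\<^sup>2 / 4)"

lemma gauss_pos [simp]: "gauss z > 0" by (simp add: gauss_def)

lemma gauss_nonneg [simp]: "gauss z \<ge> 0" by (simp add: gauss_def)

lemma gauss_0 [simp]: "gauss 0 = 1" by (simp add: gauss_def)

lemma continuous_on_gauss [continuous_intros]:
  "continuous_on S f \<Longrightarrow> continuous_on S (\<lambda>x. gauss (f x))"
  unfolding gauss_def by (intro continuous_intros) auto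

lemma integrable_gauss: "integrable lborel gauss"
  using integrable_gaussian[of "1/4", where 'a = complex] by (simp add: gauss_def[abs_def])

lemma integrable_gauss_mult:
  fixes m :: "complex \<Rightarrow> complex"
  assumes "continuous_on UNIV m" "\<And>u. cmod (m u) \<le> C"
  shows "integrable lborel (\<lambda>u. gauss u * m u)"
proof (rule Bochner_Integration.integrable_bound)
  show "integrable lborel (\<lambda>u. C * gauss u)"
    using integrable_gauss by simp
  show "(\<lambda>u. gauss u * m u) \<in> borel_measurable lborel"
    using assms(1) by (auto intro!: borel_measurable_continuous_onI continuous_intros)
  have "0 \<le> C" using assms(2)[of 0] norm_ge_zero order_trans by blast
  then show "AE u in lborel. norm (gauss u * m u) \<le> norm (C * gauss u)"
    using assms(2) by (auto simp: norm_mult mult.commute intro!: mult_right_mono)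
qed

text \<open>The growth allowed for \<open>m\<close> covers the integrand of
  \<open>gauss_transform_entire\<close>, its derivative in the parameter and its Taylor remainder.
  The second conclusion makes the bound itself integrable, which supplies the constant
  \<open>K\<close> there.\<close>

lemma integrable_gauss_exp:
  fixes m :: "complex \<Rightarrow> complex"
  assumes "continuous_on UNIV m" "\<And>u. cmod (m u) \<le> C * (cmod u)\<^sup>2 * exp (k * cmod u) + D * exp (k * cmod u)"
    and "C \<ge> 0" "D \<ge> 0"
  shows "integrable lborel (\<lambda>u. gauss u * m u)"
    and "integrable lborel (\<lambda>u. gauss u * (C * (cmod u)\<^sup>2 * exp (k * cmod u) + D * exp (k * cmod u)))"
proof -
  let ?b = "\<lambda>u::complex. (C * (16 * exp (4 * k\<^sup>2)) + D * exp (2 * k\<^sup>2)) * exp (- (1/8) * (cmod u)\<^sup>2)"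
  have int: "integrable lborel ?b"
    using integrable_gaussian[of "1/8", where 'a = complex] by (intro integrable_mult_right) simp
  have b: "gauss u * (C * (cmod u)\<^sup>2 * exp (k * cmod u) + D * exp (k * cmod u)) \<le> ?b u" for u
  proof -
    have "gauss u * (C * (cmod u)\<^sup>2 * exp (k * cmod u) + D * exp (k * cmod u)) =
        C * ((cmod u)\<^sup>2 * exp (k * cmod u) * exp (- (cmod u)\<^sup>2 / 4)) +
        D * (exp (k * cmod u) * exp (- (cmod u)\<^sup>2 / 4))"
      by (simp add: gauss_def algebra_simps)
    also have "\<dots> \<le> C * (16 * exp (4 * k\<^sup>2) * exp (- (1/8) * (cmod u)\<^sup>2)) +
        D * (exp (2 * k\<^sup>2) * exp (- (1/8) * (cmod u)\<^sup>2))"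
      using assms(3,4) gaussian_dominates[of "cmod u" k] by (intro add_mono mult_left_mono) auto
    finally show ?thesis by (simp add: algebra_simps)
  qed
  have nn: "0 \<le> C * (cmod u)\<^sup>2 * exp (k * cmod u) + D * exp (k * cmod u)" for u
    using assms(3,4) by simp
  show "integrable lborel (\<lambda>u. gauss u * m u)"
  proof (rule Bochner_Integration.integrable_bound[OF int])
    show "(\<lambda>u. gauss u * m u) \<in> borel_measurable lborel"
      using assms(1) by (auto intro!: borel_measurable_continuous_onI continuous_intros)
    have "norm (gauss u * m u) \<le> ?b u" for u
      using order_trans[OF mult_left_mono[OF assms(2) gauss_nonneg] b[of u]]
      by (simp add: norm_mult)
    then show "AE u in lborel. norm (gauss u * m u) \<le> norm (?b u)"
      by (intro AE_I2) (smt (verit) real_norm_def)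
  qed
  show "integrable lborel (\<lambda>u. gauss u * (C * (cmod u)\<^sup>2 * exp (k * cmod u) + D * exp (k * cmod u)))"
  proof (rule Bochner_Integration.integrable_bound[OF int])
    show "(\<lambda>u. gauss u * (C * (cmod u)\<^sup>2 * exp (k * cmod u) + D * exp (k * cmod u))) \<in> borel_measurable lborel"
      by (auto intro!: borel_measurable_continuous_onI continuous_intros)
    have "norm (gauss u * (C * (cmod u)\<^sup>2 * exp (k * cmod u) + D * exp (k * cmod u))) \<le> ?b u" for u
      using b[of u] nn[of u] by (simp add: abs_mult)
    then show "AE u in lborel. norm (gauss u * (C * (cmod u)\<^sup>2 * exp (k * cmod u) + D * exp (k * cmod u))) \<le> norm (?b u)"
      by (intro AE_I2) (smt (verit) real_norm_def)
  qed
qed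

text \<open>Differentiation under the integral sign. The Taylor remainder \<open>R\<close> of the
  exponential is of second order in \<open>h\<close>, so the difference quotient misses the formal
  derivative \<open>D\<close> by at most a constant times \<open>cmod h\<close>.\<close>

lemma gauss_transform_entire:
  fixes m :: "complex \<Rightarrow> complex"
  assumes m: "continuous_on UNIV m" "\<And>u. cmod (m u) \<le> C"
  defines "A \<equiv> \<lambda>\<beta>. LINT u|lborel. gauss u * (exp (\<beta> * u / 2) * m u)"
  shows "A field_differentiable at \<beta>"
proof -
  have C: "C \<ge> 0" using m(2)[of 0] norm_ge_zero order_trans by blast
  have exp_le: "cmod (exp (\<gamma> * u / 2)) \<le> exp (cmod \<gamma> * cmod u)" for \<gamma> u
    using order_trans[OF norm_exp, of "\<gamma> * u / 2" "exp (cmod \<gamma> * cmod u)"]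
    by (simp add: norm_mult norm_divide)
  have int: "integrable lborel (\<lambda>u. gauss u * (exp (\<gamma> * u / 2) * m u))" for \<gamma>
  proof (rule integrable_gauss_exp(1)[where C = 0 and D = C and k = "cmod \<gamma>"])
    fix u
    have "cmod (exp (\<gamma> * u / 2) * m u) \<le> exp (cmod \<gamma> * cmod u) * C"
      unfolding norm_mult using m(2) exp_le by (intro mult_mono) auto
    then show "cmod (exp (\<gamma> * u / 2) * m u) \<le> 0 * (cmod u)\<^sup>2 * exp (cmod \<gamma> * cmod u) + C * exp (cmod \<gamma> * cmod u)"
      by (simp add: mult.commute)
  qed (use C m(1) in \<open>auto intro!: continuous_intros\<close>)
  have intD: "integrable lborel (\<lambda>u. gauss u * (u / 2 * exp (\<beta> * u / 2) * m u))"
  proof (rule integrable_gauss_exp(1)[where C = C and D = C and k = "cmod \<beta>"])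
    fix u
    have "cmod u / 2 \<le> 1 + (cmod u)\<^sup>2"
    proof -
      have "0 \<le> (cmod u - 1)\<^sup>2 + (cmod u)\<^sup>2" by simp
      then have "2 * cmod u \<le> 1 + 2 * (cmod u)\<^sup>2" by (simp add: power2_eq_square algebra_simps)
      then show ?thesis using zero_le_power2[of "cmod u"] by linarith
    qed
    then have "cmod (u / 2 * exp (\<beta> * u / 2) * m u) \<le> (1 + (cmod u)\<^sup>2) * exp (cmod \<beta> * cmod u) * C"
      unfolding norm_mult using m(2) exp_le by (intro mult_mono) (auto simp: norm_divide)
    then show "cmod (u / 2 * exp (\<beta> * u / 2) * m u)
        \<le> C * (cmod u)\<^sup>2 * exp (cmod \<beta> * cmod u) + C * exp (cmod \<beta> * cmod u)"
      by (simp add: algebra_simps)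
  qed (use C m(1) in \<open>auto intro!: continuous_intros\<close>)
  define D where "D = (LINT u|lborel. gauss u * (u / 2 * exp (\<beta> * u / 2) * m u))"
  \<comment> \<open>The rate \<open>cmod \<beta> + 1\<close> leaves room for every increment with
    \<open>cmod h \<le> 1\<close>, so \<open>K\<close> does not depend on \<open>h\<close>.\<close>
  define K where "K = (LINT u|lborel. gauss u * (C * (cmod u)\<^sup>2 * exp ((cmod \<beta> + 1) * cmod u)
      + 0 * exp ((cmod \<beta> + 1) * cmod u)))"
  have intK: "integrable lborel (\<lambda>u. gauss u * (C * (cmod u)\<^sup>2 * exp ((cmod \<beta> + 1) * cmod u)
      + 0 * exp ((cmod \<beta> + 1) * cmod u)))"
    by (rule integrable_gauss_exp(2)[where m = "\<lambda>_. 0"]) (use C in auto)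
  have est: "cmod ((A (\<beta> + h) - A \<beta>) / h - D) \<le> K * cmod h" if h: "h \<noteq> 0" "cmod h \<le> 1" for h
  proof -
    define R where "R u = exp (h * u / 2) - 1 - h * u / 2" for u
    have R: "cmod (R u) \<le> (cmod h)\<^sup>2 * (cmod u)\<^sup>2 * exp (cmod u)" for u
    proof -
      have "\<bar>Re (h * u / 2)\<bar> \<le> cmod h * cmod u / 2"
        using abs_Re_le_cmod[of "h * u / 2"] by (simp add: norm_mult norm_divide)
      also have "\<dots> \<le> 1 * cmod u"
        using mult_right_mono[OF h(2) norm_ge_zero[of u]] norm_ge_zero[of u] by linarith
      finally have e: "exp \<bar>Re (h * u / 2)\<bar> \<le> exp (cmod u)" by simp
      have "cmod (R u) \<le> exp \<bar>Re (h * u / 2)\<bar> * (cmod (h * u / 2))\<^sup>2"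
        using Taylor_exp[of "h * u / 2" 1] by (simp add: R_def algebra_simps numeral_2_eq_2)
      also have "\<dots> \<le> exp (cmod u) * ((cmod h)\<^sup>2 * (cmod u)\<^sup>2)"
        using e by (intro mult_mono) (auto simp: norm_mult norm_divide power_mult_distrib power_divide)
      finally show ?thesis by (simp add: algebra_simps)
    qed
    have intD': "integrable lborel (\<lambda>u. h * (gauss u * (u / 2 * exp (\<beta> * u / 2) * m u)))"
      by (intro integrable_mult_right intD)
    have "A (\<beta> + h) - A \<beta> - h * D = (LINT u|lborel. gauss u * (exp ((\<beta> + h) * u / 2) * m u) -
        gauss u * (exp (\<beta> * u / 2) * m u) - h * (gauss u * (u / 2 * exp (\<beta> * u / 2) * m u)))"
      unfolding A_def D_def
      by (simp only: Bochner_Integration.integral_diff[OF Bochner_Integration.integrable_diff[OF int int] intD']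
          Bochner_Integration.integral_diff[OF int int] integral_mult_right_zero)
    also have "\<dots> = (LINT u|lborel. gauss u * (R u * exp (\<beta> * u / 2) * m u))"
      by (intro Bochner_Integration.integral_cong) (auto simp: R_def algebra_simps exp_add add_divide_distrib)
    also have "cmod \<dots> \<le> (LINT u|lborel. (cmod h)\<^sup>2 * (gauss u * (C * (cmod u)\<^sup>2 * exp ((cmod \<beta> + 1) * cmod u)
      + 0 * exp ((cmod \<beta> + 1) * cmod u))))"
    proof (rule Bochner_Integration.integral_norm_bound_integral)
      have "integrable lborel (\<lambda>u. gauss u * (exp ((\<beta> + h) * u / 2) * m u) -
        gauss u * (exp (\<beta> * u / 2) * m u) - h * (gauss u * (u / 2 * exp (\<beta> * u / 2) * m u)))"
        using int intD by (intro Bochner_Integration.integrable_diff integrable_mult_right) auto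
      also have "(\<lambda>u. gauss u * (exp ((\<beta> + h) * u / 2) * m u) -
        gauss u * (exp (\<beta> * u / 2) * m u) - h * (gauss u * (u / 2 * exp (\<beta> * u / 2) * m u))) =
          (\<lambda>u. gauss u * (R u * exp (\<beta> * u / 2) * m u))"
        by (auto simp: R_def algebra_simps exp_add add_divide_distrib)
      finally show "integrable lborel (\<lambda>u. gauss u * (R u * exp (\<beta> * u / 2) * m u))" .
      show "integrable lborel (\<lambda>u. (cmod h)\<^sup>2 * (gauss u * (C * (cmod u)\<^sup>2 * exp ((cmod \<beta> + 1) * cmod u)
      + 0 * exp ((cmod \<beta> + 1) * cmod u))))"
        using intK by (rule integrable_mult_right)
      fix u :: complex
      have "cmod (R u * exp (\<beta> * u / 2) * m u) \<le>
          ((cmod h)\<^sup>2 * (cmod u)\<^sup>2 * exp (cmod u)) * exp (cmod \<beta> * cmod u) * C"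
        unfolding norm_mult using m(2) exp_le R by (intro mult_mono) auto
      also have "\<dots> = (cmod h)\<^sup>2 * (C * (cmod u)\<^sup>2 * exp ((cmod \<beta> + 1) * cmod u))"
        by (simp add: algebra_simps exp_add)
      finally show "norm (gauss u * (R u * exp (\<beta> * u / 2) * m u)) \<le> (cmod h)\<^sup>2 * (gauss u * (C * (cmod u)\<^sup>2 * exp ((cmod \<beta> + 1) * cmod u)
      + 0 * exp ((cmod \<beta> + 1) * cmod u)))"
        using mult_left_mono[OF _ gauss_nonneg[of u]] by (simp add: norm_mult mult_ac)
    qed
    also have "\<dots> = (cmod h)\<^sup>2 * K" by (simp add: K_def)
    finally have "cmod (A (\<beta> + h) - A \<beta> - h * D) / cmod h \<le> (cmod h)\<^sup>2 * K / cmod h"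
      by (intro divide_right_mono) auto
    also have "cmod (A (\<beta> + h) - A \<beta> - h * D) / cmod h = cmod ((A (\<beta> + h) - A \<beta>) / h - D)"
      unfolding norm_divide[symmetric] using h by (simp add: field_simps)
    finally show ?thesis using h by (simp add: power2_eq_square mult.commute)
  qed
  have "((\<lambda>h. (A (\<beta> + h) - A \<beta>) / h - D) \<longlongrightarrow> 0) (at 0)"
  proof (rule Lim_null_comparison)
    show "\<forall>\<^sub>F h in at 0. norm ((A (\<beta> + h) - A \<beta>) / h - D) \<le> K * cmod h"
      unfolding eventually_at using est by (intro exI[of _ 1]) auto
    show "((\<lambda>h. K * cmod h) \<longlongrightarrow> 0) (at 0)"
      by (auto intro!: tendsto_eq_intros)
  qed
  then have "(A has_field_derivative D) (at \<beta>)"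
    unfolding DERIV_def by (rule LIM_zero_cancel)
  then show ?thesis using field_differentiable_def by blast
qed

text \<open>At each point the real derivative of \<open>A\<close> is both complex linear and
  antilinear; comparing its values at 1 and \<open>\<i>\<close> shows that it vanishes.\<close>

lemma holomorphic_antiholomorphic_constant:
  fixes A B :: "complex \<Rightarrow> complex"
  assumes A: "\<And>z. A field_differentiable at z" and B: "\<And>z. B field_differentiable at z"
    and AB: "\<And>z. A z = cnj (B (- z))"
  shows "A z = A 0"
proof -
  have "(A has_field_derivative 0) (at z)" for z
  proof -
    obtain a where a: "(A has_field_derivative a) (at z)"
      using A field_differentiable_def by blast
    obtain b where b: "(B has_field_derivative b) (at (- z))"
      using B field_differentiable_def by blast
    have "((\<lambda>z. B (- z)) has_field_derivative b * (- 1)) (at z)"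
      by (rule DERIV_chain2[where f = B and g = uminus, OF b]) (auto intro!: derivative_eq_intros)
    then have "((\<lambda>z. B (- z)) has_derivative (*) (- b)) (at z)"
      by (simp add: has_field_derivative_def)
    then have "((\<lambda>z. cnj (B (- z))) has_derivative (\<lambda>h. cnj (- b * h))) (at z)"
      by (rule bounded_linear.has_derivative[OF bounded_linear_cnj])
    then have "(A has_derivative (\<lambda>h. cnj (- b * h))) (at z)"
      by (simp add: AB[abs_def])
    moreover have "(A has_derivative (*) a) (at z)"
      using a by (simp add: has_field_derivative_def)
    ultimately have eq: "(*) a = (\<lambda>h. cnj (- b * h))"
      by (rule has_derivative_unique[rotated])
    from fun_cong[OF eq, of 1] fun_cong[OF eq, of \<i>] have "a = 0"
      by (auto simp: complex_eq_iff)
    then show ?thesis using a by simp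
  qed
  then show ?thesis
    using has_field_derivative_zero_constant[of UNIV A] by (metis UNIV_I convex_UNIV)
qed

subsection \<open>Injectivity of the Fourier transform at a point\<close>

lemma cos_power_le_1: "\<bar>cos (x::real) ^ n\<bar> \<le> 1"
  by (simp add: power_abs power_le_one)

text \<open>cos (x/k) = 1 - x^2/(2 k^2) + O(k^-4) is raised to the power k^2. Gaussians thus become
  limits of trigonometric polynomials bounded by 1, and no Fourier inversion is required.\<close>

lemma cos_power_tendsto_gaussian:
  fixes x :: real
  shows "(\<lambda>k::nat. cos (x / real k) ^ (k * k)) \<longlonglongrightarrow> exp (- (x\<^sup>2 / 2))"
proof -
  have pos: "(\<lambda>k::nat. cos (x / real k) ^ (k * k)) \<longlonglongrightarrow> exp (- (x * x / 2))" if "x > 0" for x :: real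
    using that by real_asymp
  consider "x > 0" | "x = 0" | "- x > 0" by linarith
  then show ?thesis
  proof cases
    case 1
    then show ?thesis using pos[of x] by (simp add: power2_eq_square)
  next
    case 2
    then show ?thesis by simp
  next
    case 3
    then show ?thesis using pos[of "- x"] by (simp add: power2_eq_square)
  qed
qed

text \<open>Im (cnj z * w) is the standard symplectic form of the plane.\<close>

lemma annihilator_cos:
  fixes f :: "complex \<Rightarrow> complex"
  assumes f: "continuous_on UNIV f" "\<And>u. cmod (f u) \<le> C"
    and ann: "\<And>b. (LINT u|lborel. gauss u * (cis (Im (cnj u * b)) * f u)) = 0"
  shows "(LINT u|lborel. gauss u * (cis (Im (cnj u * b)) * (complex_of_real (cos (Im (cnj u * d))) * f u))) = 0"
proof -
  define X where "X b u = gauss u * (cis (Im (cnj u * b)) * f u)" for b u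
  have int: "integrable lborel (X b)" for b
    unfolding X_def using f by (intro integrable_gauss_mult[where C = C])
      (auto intro!: continuous_intros simp: norm_mult cis_conv_exp)
  have X: "(LINT u|lborel. X b u) = 0" for b
    unfolding X_def by (rule ann)
  have cos: "complex_of_real (cos t) = (cis t + cis (- t)) / 2" for t
    by (simp add: complex_eq_iff)
  have "cis (Im (cnj u * b)) * complex_of_real (cos (Im (cnj u * d))) =
      (cis (Im (cnj u * (b + d))) + cis (Im (cnj u * (b - d)))) / 2" for u
    unfolding cos by (simp add: distrib_left right_diff_distrib cis_mult del: times_complex.sel)
  from arg_cong[OF this, of "\<lambda>z. z * f _"]
  have eq: "cis (Im (cnj u * b)) * (complex_of_real (cos (Im (cnj u * d))) * f u) =
      (cis (Im (cnj u * (b + d))) + cis (Im (cnj u * (b - d)))) / 2 * f u" for u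
    by (simp only: mult.assoc)
  have "gauss u * (cis (Im (cnj u * b)) * (complex_of_real (cos (Im (cnj u * d))) * f u)) =
      X (b + d) u / 2 + X (b - d) u / 2" for u
    unfolding X_def by (subst eq) (simp add: algebra_simps add_divide_distrib del: times_complex.sel)
  then show ?thesis
    using X int by (simp add: Bochner_Integration.integral_add del: times_complex.sel)
qed

text \<open>A cosine factor averages the characters of frequencies \<open>b + d\<close> and
  \<open>b - d\<close>. Since all frequencies are annihilated at once, the hypothesis reproduces
  itself with each further factor.\<close>

lemma annihilator_cos_power:
  fixes f :: "complex \<Rightarrow> complex"
  assumes f: "continuous_on UNIV f" "\<And>u. cmod (f u) \<le> C"
    and ann: "\<And>b. (LINT u|lborel. gauss u * (cis (Im (cnj u * b)) * f u)) = 0"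
  shows "(LINT u|lborel. gauss u * (cis (Im (cnj u * b)) * (complex_of_real (cos (Im (cnj u * d)) ^ n) * f u))) = 0"
proof (induction n arbitrary: b)
  case 0
  then show ?case using ann by simp
next
  case (Suc n)
  have "(LINT u|lborel. gauss u * (cis (Im (cnj u * b)) * (complex_of_real (cos (Im (cnj u * d))) *
      (complex_of_real (cos (Im (cnj u * d)) ^ n) * f u)))) = 0"
  proof (rule annihilator_cos[where C = C])
    fix u
    show "cmod (complex_of_real (cos (Im (cnj u * d)) ^ n) * f u) \<le> C"
      using mult_mono[OF cos_power_le_1 f(2)] by (simp add: norm_mult norm_power power_abs)
  qed (use Suc f in \<open>auto intro!: continuous_intros\<close>)
  then show ?case by (simp add: mult.assoc)
qed

text \<open>Dominated convergence, with \<open>C * gauss u\<close> as majorant, carries the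
  vanishing from products of cosine powers to their Gaussian limit.\<close>

lemma annihilator_gaussian:
  fixes f :: "complex \<Rightarrow> complex"
  assumes f: "continuous_on UNIV f" "\<And>u. cmod (f u) \<le> C"
    and ann: "\<And>b. (LINT u|lborel. gauss u * (cis (Im (cnj u * b)) * f u)) = 0"
  shows "(LINT u|lborel. gauss u * (complex_of_real (exp (- (l * cmod u)\<^sup>2 / 2)) * f u)) = 0"
proof -
  \<comment> \<open>The two frequencies are chosen such that the cosines have arguments
    \<open>l * Re u / k\<close> and \<open>l * Im u / k\<close>; the limits multiply to a radial
    Gaussian.\<close>
  define F where "F k u = complex_of_real (cos (Im (cnj u * (of_real (l / real k) * \<i>))) ^ (k * k)) *
      (complex_of_real (cos (Im (cnj u * of_real (- l / real k))) ^ (k * k)) * f u)" for k :: nat and u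
  have F: "continuous_on UNIV (F k)" for k
    unfolding F_def using f(1) by (intro continuous_intros) auto
  have bound: "cmod (complex_of_real (cos (g u) ^ n) * h u) \<le> C" if "\<And>u. cmod (h u) \<le> C"
    for g and h :: "complex \<Rightarrow> complex" and n u
    using mult_mono[OF cos_power_le_1 that] by (simp add: norm_mult norm_power power_abs)
  have FC: "cmod (F k u) \<le> C" for k u
    unfolding F_def by (intro bound f(2))
  have "(LINT u|lborel. gauss u * (cis (Im (cnj u * 0)) * F k u)) = 0" for k
    unfolding F_def
    by (intro annihilator_cos_power[where C = C] bound f ann continuous_intros)
  then have zero: "(LINT u|lborel. gauss u * F k u) = 0" for k by simp
  have "(\<lambda>k. LINT u|lborel. gauss u * F k u) \<longlonglongrightarrow>
      (LINT u|lborel. gauss u * (complex_of_real (exp (- (l * cmod u)\<^sup>2 / 2)) * f u))"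
  proof (rule integral_dominated_convergence[where w = "\<lambda>u. C * gauss u"])
    show "integrable lborel (\<lambda>u. C * gauss u)" using integrable_gauss by simp
    show "(\<lambda>u. gauss u * F k u) \<in> borel_measurable lborel" for k
      using F by (auto intro!: borel_measurable_continuous_onI continuous_intros)
    show "(\<lambda>u. gauss u * (complex_of_real (exp (- (l * cmod u)\<^sup>2 / 2)) * f u)) \<in> borel_measurable lborel"
      using f by (auto intro!: borel_measurable_continuous_onI continuous_intros)
    show "AE u in lborel. norm (gauss u * F k u) \<le> C * gauss u" for k
      using FC by (auto simp: norm_mult mult.commute intro!: mult_right_mono)
    show "AE u in lborel. (\<lambda>k. gauss u * F k u) \<longlonglongrightarrow>
        gauss u * (complex_of_real (exp (- (l * cmod u)\<^sup>2 / 2)) * f u)"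
    proof (intro AE_I2 tendsto_mult_left)
      fix u
      have "(\<lambda>k. F k u) \<longlonglongrightarrow> complex_of_real (exp (- ((l * Re u)\<^sup>2 / 2))) *
          (complex_of_real (exp (- ((l * Im u)\<^sup>2 / 2))) * f u)"
        using cos_power_tendsto_gaussian[of "l * Re u"] cos_power_tendsto_gaussian[of "l * Im u"]
        unfolding F_def by (intro tendsto_mult tendsto_of_real tendsto_const) (simp_all add: mult.commute)
      also have "complex_of_real (exp (- ((l * Re u)\<^sup>2 / 2))) * (complex_of_real (exp (- ((l * Im u)\<^sup>2 / 2))) * f u) =
          complex_of_real (exp (- (l * cmod u)\<^sup>2 / 2)) * f u"
        by (simp add: mult.assoc[symmetric] of_real_mult[symmetric] mult_exp_exp power_mult_distrib cmod_power2
              add_divide_distrib ring_distribs del: of_real_mult)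
      finally show "(\<lambda>k. F k u) \<longlonglongrightarrow> complex_of_real (exp (- (l * cmod u)\<^sup>2 / 2)) * f u" .
    qed
  qed
  then show ?thesis using zero LIMSEQ_unique tendsto_const by (metis (no_types, lifting) ext)
qed

text \<open>As l grows, the Gaussians of the preceding lemma concentrate at the origin.\<close>

lemma gauss_fourier_zero:
  fixes f :: "complex \<Rightarrow> complex"
  assumes f: "continuous_on UNIV f" "\<And>u. cmod (f u) \<le> C"
    and ann: "\<And>b. (LINT u|lborel. gauss u * (cis (Im (cnj u * b)) * f u)) = 0"
  shows "f 0 = 0"
proof (rule ccontr)
  assume f0: "f 0 \<noteq> 0"
  \<comment> \<open>Pairing with \<open>f 0\<close> makes the function real, with the positive value
    \<open>(cmod (f 0))^2\<close> at the origin.\<close>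
  define g where "g u = Re (cnj (f 0) * f u)" for u
  have g: "continuous_on UNIV g"
    unfolding g_def using f(1) by (intro continuous_intros) auto
  define c where "c = g 0 / 2"
  have c: "c > 0" "g 0 > c"
  proof -
    have "g 0 = (cmod (f 0))\<^sup>2"
      unfolding cmod_power2 g_def by (simp add: power2_eq_square)
    then have "g 0 > 0" using f0 by simp
    then show "c > 0" "g 0 > c" by (simp_all add: c_def)
  qed
  define K where "K = C * C"
  have gK: "\<bar>g u\<bar> \<le> K" for u
  proof -
    have "\<bar>g u\<bar> \<le> cmod (cnj (f 0) * f u)"
      unfolding g_def by (rule abs_Re_le_cmod)
    also have "\<dots> \<le> C * C"
      unfolding norm_mult using f(2) order_trans[OF norm_ge_zero f(2)] by (intro mult_mono) auto
    finally show ?thesis by (simp add: K_def)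
  qed
  have K: "K \<ge> 0" using gK[of 0] by linarith
  have "isCont g 0" using g by (simp add: continuous_on_eq_continuous_at)
  then have "\<forall>\<^sub>F u in at 0. g u > c"
    using c by (auto simp: isCont_def intro: order_tendstoD)
  then obtain r where r: "r > 0" "\<And>u. u \<noteq> 0 \<Longrightarrow> cmod u < r \<Longrightarrow> g u > c"
    unfolding eventually_at by auto
  have gc: "g u > c" if "cmod u < r" for u
    using r(2)[of u] that c by (cases "u = 0") auto
  have zero: "(LINT u|lborel. gauss u * (exp (- (l * cmod u)\<^sup>2 / 2) * g u)) = 0" for l
  proof -
    let ?F = "\<lambda>u. gauss u * (complex_of_real (exp (- (l * cmod u)\<^sup>2 / 2)) * f u)"
    have "integrable lborel ?F"
    proof (rule integrable_gauss_mult[where C = C])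
      show "cmod (complex_of_real (exp (- (l * cmod u)\<^sup>2 / 2)) * f u) \<le> C" for u
        using mult_mono[of "exp (- (l * cmod u)\<^sup>2 / 2)" 1 "cmod (f u)" C] f(2) by (simp add: norm_mult)
    qed (use f(1) in \<open>auto intro!: continuous_intros\<close>)
    then have "(LINT u|lborel. Re (cnj (f 0) * ?F u)) = Re (cnj (f 0) * (LINT u|lborel. ?F u))"
      by (subst integral_Re) auto
    also have "\<dots> = 0" using annihilator_gaussian[OF f ann, of l] by simp
    also have "(\<lambda>u. Re (cnj (f 0) * ?F u)) = (\<lambda>u. gauss u * (exp (- (l * cmod u)\<^sup>2 / 2) * g u))"
      by (auto simp: g_def algebra_simps)
    finally show ?thesis .
  qed
  \<comment> \<open>On the ball of radius \<open>r / 2\<close> the weight is at least exp (- r^2/16)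
    and \<open>g\<close> exceeds \<open>c\<close>: \<open>\<alpha>\<close> bounds the gain there
    from below. \<open>\<beta>\<close> bounds the possible loss outside radius
    \<open>r\<close>.\<close>
  define \<alpha> where "\<alpha> = c * exp (- r\<^sup>2 / 16) * measure lborel (ball (0::complex) (r / 2))"
  define \<beta> where "\<beta> = K * (LINT u|lborel. gauss u)"
  have \<alpha>: "\<alpha> > 0"
    using c r(1) content_ball_pos[of "r / 2" "0::complex"] by (simp add: \<alpha>_def)
  \<comment> \<open>The total integral is zero. The inner ball contributes at least the left side,
    the shell up to radius \<open>r\<close> nothing negative, and the exterior at worst minus the
    right side.\<close>
  have ineq: "\<alpha> * exp (- (l * (r / 2))\<^sup>2 / 2) \<le> \<beta> * exp (- (l * r)\<^sup>2 / 2)" for l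
  proof -
    let ?e = "\<lambda>t. exp (- (l * t)\<^sup>2 / 2)"
    have mono: "?e t \<le> ?e t'" if "0 \<le> t'" "t' \<le> t" for t t'
      using that by (auto simp: power_mult_distrib intro!: mult_left_mono power_mono)
    have "?e (r / 2) * (c * exp (- r\<^sup>2 / 16)) * indicat_real (ball 0 (r / 2)) u - ?e r * K * gauss u \<le>
       gauss u * (?e (cmod u) * g u)" for u
    proof (cases "cmod u < r")
      case True
      then have gpos: "g u > 0" using gc c(1) by fastforce
      have "?e (r / 2) * (c * exp (- r\<^sup>2 / 16)) * indicat_real (ball 0 (r / 2)) u \<le> gauss u * (?e (cmod u) * g u)"
      proof (cases "cmod u < r / 2")
        case small: True
        have "(cmod u)\<^sup>2 \<le> (r / 2)\<^sup>2" using small by (intro power_mono) auto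
        then have "exp (- r\<^sup>2 / 16) \<le> gauss u" by (simp add: gauss_def power_divide)
        then have "exp (- r\<^sup>2 / 16) * (?e (r / 2) * c) \<le> gauss u * (?e (cmod u) * g u)"
          using mono[of "cmod u" "r / 2"] small gc[OF True] c by (intro mult_mono) auto
        then show ?thesis using small by (simp add: algebra_simps)
      qed (use gpos in auto)
      then show ?thesis using K by (smt (verit) gauss_nonneg exp_ge_zero mult_nonneg_nonneg)
    next
      case False
      have "?e (cmod u) * - g u \<le> ?e r * K"
        using mono[of r "cmod u"] False r(1) gK[of u] K by (intro order_trans[OF mult_left_mono mult_right_mono]) auto
      then have "gauss u * (?e (cmod u) * - g u) \<le> gauss u * (?e r * K)"
        by (intro mult_left_mono) auto
      moreover have "u \<notin> ball 0 (r / 2)" using False r(1) by simp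
      ultimately show ?thesis by (simp add: algebra_simps)
    qed
    then have "(LINT u|lborel. ?e (r / 2) * (c * exp (- r\<^sup>2 / 16)) * indicat_real (ball 0 (r / 2)) u - ?e r * K * gauss u)
       \<le> (LINT u|lborel. gauss u * (?e (cmod u) * g u))"
    proof (intro integral_mono)
      show "integrable lborel (\<lambda>u. ?e (r / 2) * (c * exp (- r\<^sup>2 / 16)) * indicat_real (ball (0::complex) (r / 2)) u - ?e r * K * gauss u)"
        using integrable_gauss emeasure_bounded_finite[OF bounded_ball, of "0::complex" "r / 2"]
        by (intro Bochner_Integration.integrable_diff integrable_mult_right) (auto simp: less_top)
      show "integrable lborel (\<lambda>u. gauss u * (?e (cmod u) * g u))"
      proof (rule Bochner_Integration.integrable_bound)
        show "integrable lborel (\<lambda>u. K * gauss u)" using integrable_gauss by simp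
        show "(\<lambda>u. gauss u * (?e (cmod u) * g u)) \<in> borel_measurable lborel"
          using g by (auto intro!: borel_measurable_continuous_onI continuous_intros)
        have "gauss u * (?e (cmod u) * \<bar>g u\<bar>) \<le> gauss u * (1 * K)" for u
          using gK by (intro mult_left_mono mult_mono) auto
        then show "AE u in lborel. norm (gauss u * (?e (cmod u) * g u)) \<le> norm (K * gauss u)"
          using K by (auto simp: abs_mult mult.commute)
      qed
    qed
    also have "\<dots> = 0" by (rule zero)
    also have "(LINT u|lborel. ?e (r / 2) * (c * exp (- r\<^sup>2 / 16)) * indicat_real (ball (0::complex) (r / 2)) u - ?e r * K * gauss u)
        = \<alpha> * ?e (r / 2) - \<beta> * ?e r"
      using integrable_gauss emeasure_bounded_finite[OF bounded_ball, of "0::complex" "r / 2"]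
      by (subst Bochner_Integration.integral_diff)
         (auto simp: less_top \<alpha>_def \<beta>_def intro!: integrable_mult_right)
    finally show ?thesis by simp
  qed
  \<comment> \<open>With \<open>l = sqrt n\<close> the two exponents of \<open>ineq\<close> are - n
    r^2/8 and - n r^2/2; they differ by 3 n r^2/8, which forces \<open>\<alpha>\<close> below every
    positive number.\<close>
  have "(\<lambda>n. \<beta> * exp (- (3 * r\<^sup>2 / 8) * real n)) \<longlonglongrightarrow> 0"
    using r(1) by real_asymp
  moreover have "\<alpha> \<le> \<beta> * exp (- (3 * r\<^sup>2 / 8) * real n)" for n
  proof -
    have "(sqrt (real n))\<^sup>2 = real n" by simp
    then have "\<alpha> * exp (- (real n * r\<^sup>2 / 8)) \<le> \<beta> * exp (- (real n * r\<^sup>2 / 2))"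
      using ineq[of "sqrt (real n)"] by (simp add: power_mult_distrib power_divide)
    then have "\<alpha> * exp (- (real n * r\<^sup>2 / 8)) * exp (real n * r\<^sup>2 / 8) \<le>
        \<beta> * exp (- (real n * r\<^sup>2 / 2)) * exp (real n * r\<^sup>2 / 8)"
      by (intro mult_right_mono) auto
    then show ?thesis by (simp add: mult.assoc mult_exp_exp algebra_simps)
  qed
  ultimately have "\<alpha> \<le> 0" by (intro LIMSEQ_le_const) auto
  then show False using \<alpha> by simp
qed

subsection \<open>Weyl systems on the plane\<close>

lemma cinner_add_left: "cinner (x + y) (z::'h::complex_hilbert) = cinner x z + cinner y z"
  by (metis cinner_commute cinner_add_right complex_cnj_add)

lemma cinner_scaleC_left: "cinner (a *\<^sub>C x) (y::'h::complex_hilbert) = cnj a * cinner x y"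
  by (metis cinner_commute cinner_scaleC_right complex_cnj_mult)

lemma scaleC_one [simp]: "1 *\<^sub>C (x::'h::complex_hilbert) = x"
  using scaleC_of_real[of 1 x] by simp

lemma scaleC_zero_left [simp]: "0 *\<^sub>C (x::'h::complex_hilbert) = 0"
  using scaleC_of_real[of 0 x] by simp

lemma scaleC_diff_minus: "x - y = x + (- 1) *\<^sub>C (y::'h::complex_hilbert)"
  using scaleC_of_real[of "- 1" y] by simp

lemma cinner_diff_right: "cinner (x::'h::complex_hilbert) (y - z) = cinner x y - cinner x z"
  by (simp add: scaleC_diff_minus[of y z] cinner_add_right cinner_scaleC_right)

lemma cinner_diff_left: "cinner (x - y) (z::'h::complex_hilbert) = cinner x z - cinner y z"
  by (simp add: scaleC_diff_minus[of x y] cinner_add_left cinner_scaleC_left)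

lemma norm_scaleC: "norm (a *\<^sub>C (x::'h::complex_hilbert)) = cmod a * norm x"
proof -
  have "complex_of_real ((norm (a *\<^sub>C x))\<^sup>2) = complex_of_real ((cmod a * norm x)\<^sup>2)"
    unfolding cinner_self[symmetric] cinner_scaleC_left cinner_scaleC_right
    by (simp add: cinner_self power_mult_distrib complex_norm_square mult.assoc[symmetric]
        mult.commute del: of_real_power)
  then show ?thesis
    by (simp add: of_real_eq_iff power2_eq_iff_nonneg del: of_real_power of_real_mult)
qed

lemma cinner_Cauchy_Schwarz: "cmod (cinner (x::'h::complex_hilbert) y) \<le> norm x * norm y"
proof (cases "x = 0")
  case True
  then show ?thesis using cinner_scaleC_left[of 0 x y] by simp
next
  case False
  define n where "n = (norm x)\<^sup>2"
  define c where "c = cinner x y"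
  have n: "n > 0" using False by (simp add: n_def)
  have yx: "cinner y x = cnj c" unfolding c_def by (rule cinner_commute)
  \<comment> \<open>The component of \<open>y\<close> orthogonal to \<open>x\<close>, multiplied by
    the squared norm of \<open>x\<close> to avoid division.\<close>
  let ?z = "complex_of_real n *\<^sub>C y - c *\<^sub>C x"
  have "complex_of_real ((norm ?z)\<^sup>2) = complex_of_real (n * (n * (norm y)\<^sup>2 - (cmod c)\<^sup>2))"
    unfolding cinner_self[symmetric] cinner_diff_left cinner_diff_right cinner_scaleC_left cinner_scaleC_right
      yx c_def[symmetric]
    by (simp add: cinner_self n_def[symmetric] complex_norm_square[of c] algebra_simps del: of_real_power)
  then have "(norm ?z)\<^sup>2 = n * (n * (norm y)\<^sup>2 - (cmod c)\<^sup>2)"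
    by (simp only: of_real_eq_iff)
  then have "0 \<le> n * (n * (norm y)\<^sup>2 - (cmod c)\<^sup>2)"
    by (metis zero_le_power2)
  then have "(cmod c)\<^sup>2 \<le> (norm x * norm y)\<^sup>2"
    using n by (simp add: zero_le_mult_iff n_def power_mult_distrib)
  then show ?thesis unfolding c_def by (rule power2_le_imp_le) simp
qed

lemma bounded_bilinear_cinner: "bounded_bilinear (cinner :: 'h::complex_hilbert \<Rightarrow> _)"
proof
  show "\<exists>K. \<forall>(a::'h) b. cmod (cinner a b) \<le> norm a * norm b * K"
    using cinner_Cauchy_Schwarz by (intro exI[of _ 1]) auto
qed (simp_all add: cinner_add_left cinner_add_right scaleC_of_real[where 'a = 'h, symmetric]
    cinner_scaleC_left cinner_scaleC_right scaleR_conv_of_real del: scaleC_of_real)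

lemma bounded_bilinear_scaleC: "bounded_bilinear (scaleC :: complex \<Rightarrow> 'h::complex_hilbert \<Rightarrow> 'h)"
proof
  show "\<exists>K. \<forall>a (b::'h). norm (a *\<^sub>C b) \<le> cmod a * norm b * K"
    by (intro exI[of _ 1]) (simp add: norm_scaleC)
qed (simp_all add: scaleC_add_left scaleC_add_right scaleC_of_real[where 'a = 'h, symmetric] scaleC_scaleC
    scaleR_conv_of_real mult.commute del: scaleC_of_real)

lemma
  assumes "unitary U"
  shows unitary_add: "U (x + y) = U x + U y"
    and unitary_scaleC: "U (c *\<^sub>C x) = c *\<^sub>C U x"
    and unitary_cinner: "cinner (U x) (U y) = cinner x y"
    and unitary_norm: "norm (U x) = norm x"
    and unitary_bij: "bij U"
    and unitary_bounded_linear: "bounded_linear U"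
proof -
  interpret U: Vector_Spaces.linear scaleC scaleC U
    using assms unfolding unitary_def by blast
  show add: "U (x + y) = U x + U y" for x y by (rule U.add)
  show sc: "U (c *\<^sub>C x) = c *\<^sub>C U x" for c x by (rule U.scale)
  show ci: "cinner (U x) (U y) = cinner x y" for x y using assms unfolding unitary_def by blast
  have "complex_of_real ((norm (U x))\<^sup>2) = complex_of_real ((norm x)\<^sup>2)" for x
    unfolding cinner_self[symmetric] by (rule ci)
  then show no: "norm (U x) = norm x" for x
    by (simp add: of_real_eq_iff power2_eq_iff_nonneg del: of_real_power)
  show "bij U" using assms unfolding unitary_def by blast
  show "bounded_linear U"
    by (rule bounded_linear_intro[where K = 1])
      (simp_all add: add sc no scaleC_of_real[symmetric] del: scaleC_of_real)
qed

section \<open>The Gaussian mean of a Weyl system on the plane\<close>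

lemma LINT_translate:
  fixes f :: "'a::euclidean_space \<Rightarrow> 'b::{banach, second_countable_topology}"
  assumes "f \<in> borel_measurable borel"
  shows "(LINT z|lborel. f (a + z)) = (LINT u|lborel. f u)"
  using integral_distr[of "(+) a" lborel borel f] assms by (simp add: lborel_distr_plus)

text \<open>The cross term of |u - a|^2 supplies the real part, and the Weyl phase the imaginary
  part, of the single exponent \<open>cnj a * u / 2\<close>. The factor 1/4 in \<open>gauss\<close>
  is matched to the factor 1/2 in the phase for this purpose.\<close>

lemma gauss_shift:
  "complex_of_real (gauss (u - a)) * cis (Im (cnj a * u) / 2) = gauss a * (gauss u * exp (cnj a * u / 2))"
proof -
  have "(cmod (u - a))\<^sup>2 = (cmod u)\<^sup>2 + (cmod a)\<^sup>2 - 2 * Re (cnj a * u)"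
    unfolding cmod_power2 by (simp add: power2_eq_square algebra_simps)
  then have "gauss (u - a) = gauss a * gauss u * exp (Re (cnj a * u) / 2)"
    unfolding gauss_def exp_add[symmetric] by (simp add: field_simps)
  moreover have "exp (cnj a * u / 2) = exp (Re (cnj a * u) / 2) * cis (Im (cnj a * u) / 2)"
    by (subst exp_eq_polar) simp
  ultimately show ?thesis by (simp add: mult.assoc)
qed

locale weyl_plane =
  fixes Z :: "complex \<Rightarrow> 'h::complex_hilbert \<Rightarrow> 'h"
  assumes unitary_Z: "unitary (Z z)"
    and cont_Z: "continuous_on UNIV (\<lambda>z. Z z x)"
    and weyl: "Z z (Z w x) = cis (Im (cnj z * w) / 2) *\<^sub>C Z (z + w) x"
begin

lemmas Z_add = unitary_add[OF unitary_Z]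
  and Z_cinner = unitary_cinner[OF unitary_Z]
  and Z_norm = unitary_norm[OF unitary_Z]
  and Z_bounded_linear = unitary_bounded_linear[OF unitary_Z]

lemma Z_0: "Z 0 x = x"
proof -
  have "Z 0 (Z 0 x) = Z 0 x" using weyl[of 0 0 x] by simp
  then show ?thesis using unitary_bij[OF unitary_Z, of 0] by (metis bij_pointE)
qed

lemma Z_inverse: "Z z (Z (- z) x) = x"
  using weyl[of z "- z" x] by (simp add: Z_0 mult.commute)

lemma Z_adjoint: "cinner y (Z z x) = cinner (Z (- z) y) x"
  by (metis Z_cinner Z_inverse)

lemma cont_matrix_coefficient: "continuous_on UNIV (\<lambda>z. cinner y (Z z x))"
  by (rule bounded_bilinear.continuous_on[OF bounded_bilinear_cinner continuous_on_const cont_Z])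

lemma matrix_coefficient_bound: "cmod (cinner y (Z z x)) \<le> norm y * norm x"
  using cinner_Cauchy_Schwarz[of y "Z z x"] by (simp add: Z_norm)

text \<open>The Henstock-Kurzweil integral is used because the Bochner integral of the library is
  confined to second countable codomains, i.e. to separable Hilbert spaces.\<close>

definition P :: "'h \<Rightarrow> 'h" where
  "P x = integral UNIV (\<lambda>z. gauss z *\<^sub>R Z z x)"

lemma integrable_P: "(\<lambda>z. gauss z *\<^sub>R Z z x) integrable_on UNIV"
proof (rule integrable_on_all_intervals_UNIV)
  show "(\<lambda>z. gauss z *\<^sub>R Z z x) integrable_on cbox a b" for a b
    by (intro integrable_continuous continuous_intros continuous_on_subset[OF cont_Z]) auto
  show "norm (gauss z *\<^sub>R Z z x) \<le> norm x * gauss z" for z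
    by (simp add: Z_norm mult.commute)
  show "(\<lambda>z. norm x * gauss z) integrable_on UNIV"
    using integrable_gauss by (intro integrable_on_lborel) simp
qed

text \<open>Bounded operators pass through the integral. This serves both for the vacuum operator of
  the planes treated before and for \<open>V b\<close> with \<open>b\<close> orthogonal to the
  plane.\<close>

lemma P_bounded_linear_commute:
  assumes R: "bounded_linear R" and comm: "\<And>z x. R (Z z x) = Z z (R x)"
  shows "R (P x) = P (R x)"
proof -
  have "R (P x) = integral UNIV (R \<circ> (\<lambda>z. gauss z *\<^sub>R Z z x))"
    unfolding P_def by (rule integral_linear[OF integrable_P R, symmetric])
  also have "R \<circ> (\<lambda>z. gauss z *\<^sub>R Z z x) = (\<lambda>z. gauss z *\<^sub>R Z z (R x))"
    by (auto simp: linear_scale[OF bounded_linear.linear[OF R]] comm)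
  finally show ?thesis by (simp add: P_def)
qed

lemma bounded_linear_P: "bounded_linear P"
proof (rule bounded_linear_intro)
  show "P (x + y) = P x + P y" for x y
    unfolding P_def
    by (subst Henstock_Kurzweil_Integration.integral_add[OF integrable_P integrable_P, symmetric])
      (simp add: Z_add scaleR_add_right)
  show "P (r *\<^sub>R x) = r *\<^sub>R P x" for r x
    unfolding P_def
    by (subst Henstock_Kurzweil_Integration.integral_cmul[symmetric])
      (simp add: linear_scale[OF bounded_linear.linear[OF Z_bounded_linear]] mult.commute)
  show "norm (P x) \<le> norm x * integral UNIV gauss" for x
  proof -
    have "norm (P x) \<le> integral UNIV (\<lambda>z. norm x * gauss z)"
      unfolding P_def using integrable_gauss
      by (intro Henstock_Kurzweil_Integration.integral_norm_bound_integral integrable_P integrable_on_lborel)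
        (auto simp: Z_norm mult.commute)
    then show ?thesis by simp
  qed
qed

text \<open>The weak form of \<open>P\<close>: a scalar Lebesgue integral, to which the Gaussian
  estimates and translations apply.\<close>

lemma cinner_P: "cinner y (P x) = (LINT z|lborel. gauss z * cinner y (Z z x))"
proof -
  have bl: "bounded_linear (cinner y)"
    by (rule bounded_bilinear.bounded_linear_right[OF bounded_bilinear_cinner])
  have "cinner y (P x) = integral UNIV (cinner y \<circ> (\<lambda>z. gauss z *\<^sub>R Z z x))"
    unfolding P_def by (rule integral_linear[OF integrable_P bl, symmetric])
  also have "cinner y \<circ> (\<lambda>z. gauss z *\<^sub>R Z z x) = (\<lambda>z. gauss z * cinner y (Z z x))"
    by (auto simp: linear_scale[OF bounded_linear.linear[OF bl]] scaleR_conv_of_real)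
  also have "integral UNIV \<dots> = (LINT z|lborel. gauss z * cinner y (Z z x))"
    by (intro integral_lborel integrable_gauss_mult[OF cont_matrix_coefficient matrix_coefficient_bound])
  finally show ?thesis .
qed

text \<open>A transform of Bargmann type. By \<open>cinner_Z_P\<close> its value at
  \<open>cnj a\<close> is the coefficient of the coherent state \<open>Z a (P x)\<close>, stripped
  of the factor \<open>gauss a\<close>; the free parameter lets holomorphy be stated.\<close>

definition coherent :: "'h \<Rightarrow> 'h \<Rightarrow> complex \<Rightarrow> complex" where
  "coherent y x \<beta> = (LINT u|lborel. gauss u * (exp (\<beta> * u / 2) * cinner y (Z u x)))"

lemma coherent_entire: "coherent y x field_differentiable at \<beta>"
  unfolding coherent_def[abs_def]
  by (rule gauss_transform_entire[OF cont_matrix_coefficient matrix_coefficient_bound])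

lemma cinner_Z_P: "cinner y (Z a (P x)) = gauss a * coherent y x (cnj a)"
proof -
  \<comment> \<open>The integrand in the variable \<open>u = a + z\<close>. The Weyl phase keeps its
    form under the substitution because \<open>cnj a * a\<close> is real.\<close>
  define f where "f u = gauss (u - a) * (cis (Im (cnj a * u) / 2) * cinner y (Z u x))" for u
  have "cinner y (Z a (P x)) = (LINT z|lborel. gauss z * cinner y (Z a (Z z x)))"
    unfolding Z_adjoint[of y a] by (rule cinner_P)
  also have "\<dots> = (LINT z|lborel. f (a + z))"
    by (intro Bochner_Integration.integral_cong)
      (auto simp: f_def weyl cinner_scaleC_right algebra_simps)
  also have "\<dots> = (LINT u|lborel. f u)"
  proof (rule LINT_translate)
    have "continuous_on UNIV f"
      unfolding f_def cis_conv_exp by (intro continuous_intros cont_matrix_coefficient) auto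
    then show "f \<in> borel_measurable borel" by (rule borel_measurable_continuous_onI)
  qed
  also have "\<dots> = (LINT u|lborel. gauss a * (gauss u * (exp (cnj a * u / 2) * cinner y (Z u x))))"
    unfolding f_def mult.assoc[symmetric] by (simp only: gauss_shift mult.assoc)
  also have "\<dots> = gauss a * coherent y x (cnj a)"
    unfolding coherent_def by (rule integral_mult_right_zero)
  finally show ?thesis .
qed

text \<open>The adjoint of \<open>Z a\<close> is \<open>Z (- a)\<close>, so conjugation exchanges
  \<open>x\<close> with \<open>y\<close> and \<open>a\<close> with \<open>- a\<close>. The transform
  \<open>coherent (P y) x\<close> is therefore holomorphic and antiholomorphic at once, and only
  \<open>gauss a\<close> depends on \<open>a\<close>.\<close>

lemma vacuum: "cinner (P y) (Z a (P x)) = gauss a * cinner (P y) (P x)"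
proof -
  have "coherent (P y) x z = cnj (coherent (P x) y (- z))" for z
  proof -
    have "gauss z * coherent (P y) x z = cinner (P y) (Z (cnj z) (P x))"
      by (simp add: cinner_Z_P gauss_def)
    also have "\<dots> = cnj (cinner (P x) (Z (- cnj z) (P y)))"
      by (metis Z_adjoint cinner_commute)
    also have "\<dots> = gauss z * cnj (coherent (P x) y (- z))"
      by (simp add: cinner_Z_P gauss_def)
    finally show ?thesis using gauss_pos[of z] by simp
  qed
  then have const: "coherent (P y) x z = coherent (P y) x 0" for z
    by (rule holomorphic_antiholomorphic_constant[OF coherent_entire coherent_entire])
  have "cinner (P y) (P x) = coherent (P y) x 0"
    using cinner_Z_P[of "P y" 0 x] by (simp add: Z_0)
  then show ?thesis using cinner_Z_P[of "P y" a x] const[of "cnj a"] by simp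
qed

text \<open>The numbers \<open>cinner (Z b x) (P (Z b x))\<close> are the Fourier transform of the
  Gaussian times \<open>cinner x (Z u x)\<close>. If they all vanish, so does the coefficient at
  \<open>u = 0\<close>, which is the squared norm of \<open>x\<close>.\<close>

lemma P_nonvanishing:
  assumes "\<And>b. P (Z b x) = 0"
  shows "x = 0"
proof -
  have "cinner x (Z 0 x) = 0"
  proof (rule gauss_fourier_zero[OF cont_matrix_coefficient matrix_coefficient_bound])
    fix b
    \<comment> \<open>Exchanging \<open>Z u\<close> and \<open>Z b\<close> doubles the half phase of
      the Weyl relation and yields a full character of the plane.\<close>
    have "cinner (Z b x) (Z u (Z b x)) = cis (Im (cnj u * b)) * cinner x (Z u x)" for u
    proof -
      have "Z u (Z b x) = cis (Im (cnj u * b)) *\<^sub>C Z b (Z u x)"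
        by (simp add: weyl scaleC_scaleC cis_mult add.commute algebra_simps add_divide_distrib diff_divide_distrib)
      then show ?thesis by (simp add: cinner_scaleC_right Z_cinner del: times_complex.sel)
    qed
    then have "(LINT u|lborel. gauss u * (cis (Im (cnj u * b)) * cinner x (Z u x))) = cinner (Z b x) (P (Z b x))"
      by (simp add: cinner_P)
    also have "\<dots> = 0" using assms bounded_bilinear.zero_right[OF bounded_bilinear_cinner] by simp
    finally show "(LINT u|lborel. gauss u * (cis (Im (cnj u * b)) * cinner x (Z u x))) = 0" .
  qed
  then show ?thesis by (simp add: Z_0 cinner_self)
qed

end

subsection \<open>Darboux bases and the vacuum\<close>

locale antisymmetric_form =
  fixes \<omega> :: "'w::real_vector \<Rightarrow> 'w \<Rightarrow> real"
  assumes bilinear_\<omega>: "bilinear \<omega>" and antisym: "\<omega> \<xi> \<eta> = - \<omega> \<eta> \<xi>"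
begin

lemmas \<omega>_simps = bilinear_ladd[OF bilinear_\<omega>] bilinear_radd[OF bilinear_\<omega>]
  bilinear_lmul[OF bilinear_\<omega>] bilinear_rmul[OF bilinear_\<omega>]
  bilinear_lsub[OF bilinear_\<omega>] bilinear_rsub[OF bilinear_\<omega>]
  bilinear_lzero[OF bilinear_\<omega>] bilinear_rzero[OF bilinear_\<omega>]

lemma self_zero [simp]: "\<omega> \<xi> \<xi> = 0"
  using antisym[of \<xi> \<xi>] by simp

definition orth :: "('w \<times> 'w) list \<Rightarrow> 'w \<Rightarrow> bool" where
  "orth ps \<xi> \<longleftrightarrow> (\<forall>(e, f)\<in>set ps. \<omega> \<xi> e = 0 \<and> \<omega> \<xi> f = 0)"

fun darboux :: "('w \<times> 'w) list \<Rightarrow> bool" where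
  "darboux [] \<longleftrightarrow> True"
| "darboux ((e, f) # ps) \<longleftrightarrow> \<omega> e f = 1 \<and> orth ps e \<and> orth ps f \<and> darboux ps"

text \<open>For a Darboux list this is the \<open>\<omega>\<close>-orthogonal projection onto the
  span of its vectors.\<close>

fun proj :: "('w \<times> 'w) list \<Rightarrow> 'w \<Rightarrow> 'w" where
  "proj [] \<xi> = 0"
| "proj ((e, f) # ps) \<xi> = (\<omega> \<xi> f *\<^sub>R e + (- \<omega> \<xi> e) *\<^sub>R f) + proj ps \<xi>"

text \<open>The squared Euclidean length of the coordinates used in \<open>proj\<close>.\<close>

fun energy :: "('w \<times> 'w) list \<Rightarrow> 'w \<Rightarrow> real" where
  "energy [] \<xi> = 0"
| "energy ((e, f) # ps) \<xi> = (\<omega> \<xi> f)\<^sup>2 + (\<omega> \<xi> e)\<^sup>2 + energy ps \<xi>"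

lemma orth_Nil [simp]: "orth [] \<xi>"
  by (simp add: orth_def)

lemma orth_Cons [simp]: "orth ((e, f) # ps) \<xi> \<longleftrightarrow> \<omega> \<xi> e = 0 \<and> \<omega> \<xi> f = 0 \<and> orth ps \<xi>"
  by (auto simp: orth_def)

lemma orth_combination: "orth ps \<xi> \<Longrightarrow> orth ps \<eta> \<Longrightarrow> orth ps (a *\<^sub>R \<xi> + b *\<^sub>R \<eta>)"
  unfolding orth_def by (fastforce simp: \<omega>_simps)

lemma orth_proj: "orth ps \<eta> \<Longrightarrow> \<omega> \<eta> (proj ps \<xi>) = 0"
  by (induction ps \<xi> rule: proj.induct) (auto simp: \<omega>_simps)

text \<open>The corrections do not interfere: that of the head pair is orthogonal to the remaining
  pairs, and \<open>proj ps \<xi>\<close> is orthogonal to the head pair.\<close>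

lemma orth_complement: "darboux ps \<Longrightarrow> orth ps (\<xi> - proj ps \<xi>)"
proof (induction ps)
  case (Cons p ps)
  obtain e f where p: "p = (e, f)" by force
  let ?u = "\<omega> \<xi> f *\<^sub>R e + (- \<omega> \<xi> e) *\<^sub>R f"
  from Cons p have ef: "\<omega> e f = 1" "orth ps e" "orth ps f" and IH: "orth ps (\<xi> - proj ps \<xi>)"
    by auto
  have "\<omega> f e = - 1" using antisym[of f e] ef(1) by simp
  have "\<omega> (proj ps \<xi>) e = 0" "\<omega> (proj ps \<xi>) f = 0"
    using orth_proj[OF ef(2), of \<xi>] orth_proj[OF ef(3), of \<xi>]
      antisym[of "proj ps \<xi>" e] antisym[of "proj ps \<xi>" f] by simp_all
  have eq: "1 *\<^sub>R (\<xi> - proj ps \<xi>) + (- 1) *\<^sub>R ?u = \<xi> - (?u + proj ps \<xi>)"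
    by simp
  have "orth ps (\<xi> - (?u + proj ps \<xi>))"
    by (rule subst[OF eq]) (intro orth_combination IH ef)
  moreover have "\<omega> (\<xi> - (?u + proj ps \<xi>)) e = 0"
    by (simp add: \<omega>_simps \<open>\<omega> f e = - 1\<close> \<open>\<omega> (proj ps \<xi>) e = 0\<close>)
  moreover have "\<omega> (\<xi> - (?u + proj ps \<xi>)) f = 0"
    by (simp add: \<omega>_simps ef(1) \<open>\<omega> (proj ps \<xi>) f = 0\<close>)
  ultimately show ?case by (simp only: p orth_Cons proj.simps)
qed simp

text \<open>Symplectic Gram-Schmidt along \<open>bs\<close>. A nonzero residue \<open>e\<close> of
  the next vector finds a partner by nondegeneracy. The invariant speaks of orthogonality instead of
  spans: what is orthogonal to the pairs is orthogonal to every vector processed so far.\<close>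

lemma darboux_cover:
  assumes nondeg: "\<And>\<xi>. (\<And>\<eta>. \<omega> \<xi> \<eta> = 0) \<Longrightarrow> \<xi> = 0"
  shows "\<exists>ps. darboux ps \<and> (\<forall>\<xi>. orth ps \<xi> \<longrightarrow> (\<forall>b\<in>set bs. \<omega> \<xi> b = 0))"
proof (induction bs)
  case Nil
  then show ?case by (intro exI[of _ "[]"]) simp
next
  case (Cons b bs)
  then obtain ps where ps: "darboux ps" and cover: "\<And>\<xi> b. orth ps \<xi> \<Longrightarrow> b \<in> set bs \<Longrightarrow> \<omega> \<xi> b = 0"
    by blast
  define e where "e = b - proj ps b"
  have e: "orth ps e" unfolding e_def by (rule orth_complement[OF ps])
  have b: "\<omega> \<xi> b = \<omega> \<xi> e" if "orth ps \<xi>" for \<xi>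
    using orth_proj[OF that] by (simp add: e_def \<omega>_simps)
  show ?case
  proof (cases "e = 0")
    case True
    then have "\<omega> \<xi> b = 0" if "orth ps \<xi>" for \<xi>
      using b[OF that] by (simp add: \<omega>_simps)
    then show ?thesis using ps cover by (intro exI[of _ ps]) auto
  next
    case False
    then obtain \<eta> where \<eta>: "\<omega> e \<eta> \<noteq> 0" using nondeg by blast
    \<comment> \<open>Subtracting the projection does not change the pairing with \<open>e\<close>,
      which is orthogonal to \<open>ps\<close>; the scalar normalises that pairing to 1.\<close>
    define f where "f = (1 / \<omega> e \<eta>) *\<^sub>R (\<eta> - proj ps \<eta>)"
    have "orth ps f"
      using orth_combination[OF orth_complement[OF ps] orth_complement[OF ps], of "1 / \<omega> e \<eta>" \<eta> 0 0]
      by (simp add: f_def)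
    moreover have "\<omega> e f = 1"
      using \<eta> orth_proj[OF e] by (simp add: f_def \<omega>_simps)
    ultimately have "darboux ((e, f) # ps)" using e ps by simp
    moreover have "\<omega> \<xi> b' = 0" if "orth ((e, f) # ps) \<xi>" "b' \<in> set (b # bs)" for \<xi> b'
      using that b cover by auto
    ultimately show ?thesis by blast
  qed
qed

text \<open>Once a spanning set has been processed, nondegeneracy leaves only 0 orthogonal to all
  pairs, so every residue \<open>\<xi> - proj ps \<xi>\<close> vanishes.\<close>

lemma darboux_basis:
  assumes nondeg: "\<And>\<xi>. (\<And>\<eta>. \<omega> \<xi> \<eta> = 0) \<Longrightarrow> \<xi> = 0"
    and fin: "finite B" "span B = (UNIV :: 'w set)"
  obtains ps where "darboux ps" "\<And>\<xi>. proj ps \<xi> = \<xi>"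
proof -
  obtain bs where bs: "set bs = B" using fin(1) finite_list by blast
  obtain ps where ps: "darboux ps" and cover: "\<And>\<xi> b. orth ps \<xi> \<Longrightarrow> b \<in> B \<Longrightarrow> \<omega> \<xi> b = 0"
    using darboux_cover[OF nondeg, of bs] bs by blast
  have "\<xi> = 0" if "orth ps \<xi>" for \<xi>
  proof (rule nondeg)
    have "linear (\<omega> \<xi>)" using bilinear_\<omega> by (simp add: bilinear_def)
    then show "\<omega> \<xi> \<eta> = 0" for \<eta>
      using linear_eq_0_on_span[of "\<omega> \<xi>" B \<eta>] cover[OF that] fin(2) by auto
  qed
  then have "proj ps \<xi> = \<xi>" for \<xi> using orth_complement[OF ps, of \<xi>] by fastforce
  then show ?thesis using that ps by blast
qed

end

text \<open>Strong continuity is asked for along planes only, which is where the Gaussian means are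
  formed; \<open>'w\<close> then carries no topology.\<close>

locale weyl_system = antisymmetric_form \<omega>
  for \<omega> :: "'w::real_vector \<Rightarrow> 'w \<Rightarrow> real" +
  fixes V :: "'w \<Rightarrow> 'h::complex_hilbert \<Rightarrow> 'h"
  assumes unitary_V: "unitary (V \<xi>)"
    and weyl_V: "V \<xi> (V \<eta> x) = cis (\<omega> \<xi> \<eta> / 2) *\<^sub>C V (\<xi> + \<eta>) x"
    and cont_V: "continuous_on UNIV (\<lambda>z. V (Re z *\<^sub>R e + Im z *\<^sub>R f) x)"
begin

lemma V_0: "V 0 x = x"
proof -
  have "V 0 (V 0 x) = V 0 x" using weyl_V[of 0 0 x] by simp
  then show ?thesis using unitary_bij[OF unitary_V, of 0] by (metis bij_pointE)
qed

lemma V_orthogonal: "\<omega> \<xi> \<eta> = 0 \<Longrightarrow> V \<xi> (V \<eta> x) = V (\<xi> + \<eta>) x"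
  using weyl_V[of \<xi> \<eta> x] by simp

lemma V_commute: "\<omega> \<xi> \<eta> = 0 \<Longrightarrow> V \<xi> (V \<eta> x) = V \<eta> (V \<xi> x)"
  using V_orthogonal[of \<xi> \<eta> x] V_orthogonal[of \<eta> \<xi> x] antisym[of \<xi> \<eta>] by (simp add: add.commute)

lemma weyl_plane:
  assumes "\<omega> e f = 1"
  shows "weyl_plane (\<lambda>z. V (Re z *\<^sub>R e + Im z *\<^sub>R f))"
proof
  fix z w x
  have "\<omega> f e = - 1" using antisym[of f e] assms by simp
  then have "\<omega> (Re z *\<^sub>R e + Im z *\<^sub>R f) (Re w *\<^sub>R e + Im w *\<^sub>R f) = Im (cnj z * w)"
    using assms by (simp add: \<omega>_simps)
  moreover have "(Re z *\<^sub>R e + Im z *\<^sub>R f) + (Re w *\<^sub>R e + Im w *\<^sub>R f) = Re (z + w) *\<^sub>R e + Im (z + w) *\<^sub>R f"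
    by (simp add: algebra_simps)
  ultimately show "V (Re z *\<^sub>R e + Im z *\<^sub>R f) (V (Re w *\<^sub>R e + Im w *\<^sub>R f) x) =
      cis (Im (cnj z * w) / 2) *\<^sub>C V (Re (z + w) *\<^sub>R e + Im (z + w) *\<^sub>R f) x"
    by (simp only: weyl_V)
qed (rule unitary_V cont_V)+

text \<open>\<open>R\<close> is the identity for the empty list, and each plane composes its
  Gaussian mean onto it. Two vectors \<open>x\<close> and \<open>y\<close> appear in the vacuum
  identity because the induction applies it to \<open>plane.P y\<close> and
  \<open>V (L z) (plane.P x)\<close>, which differ even when \<open>x = y\<close>.\<close>

lemma vacuum_operator:
  assumes "darboux ps" and nonzero: "(x0 :: 'h) \<noteq> 0"
  shows "\<exists>R. bounded_linear R \<and> (\<exists>x. R x \<noteq> 0) \<and>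
    (\<forall>b x. orth ps b \<longrightarrow> R (V b x) = V b (R x)) \<and>
    (\<forall>x y \<xi>. cinner (R y) (V (proj ps \<xi>) (R x)) = exp (- energy ps \<xi> / 4) * cinner (R y) (R x))"
  using assms(1)
proof (induction ps)
  case Nil
  then show ?case
    using nonzero by (intro exI[of _ "\<lambda>x. x"]) (auto simp: V_0)
next
  case (Cons p ps)
  obtain e f where p: "p = (e, f)" by force
  from Cons p have ef: "\<omega> e f = 1" "orth ps e" "orth ps f"
    by auto
  from Cons p obtain R where R: "bounded_linear R" and nz: "\<exists>x. R x \<noteq> 0"
    and comm: "\<And>b x. orth ps b \<Longrightarrow> R (V b x) = V b (R x)"
    and vac: "\<And>x y \<xi>. cinner (R y) (V (proj ps \<xi>) (R x)) = exp (- energy ps \<xi> / 4) * cinner (R y) (R x)"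
    by auto
  define L where "L z = Re z *\<^sub>R e + Im z *\<^sub>R f" for z
  interpret plane: weyl_plane "\<lambda>z. V (L z)"
    unfolding L_def by (rule weyl_plane[OF ef(1)])
  have orth_L: "orth ps (L z)" for z
    unfolding L_def by (intro orth_combination ef)
  have RP: "R (plane.P x) = plane.P (R x)" for x
    by (rule plane.P_bounded_linear_commute[OF R]) (rule comm[OF orth_L])
  obtain x1 where "R x1 \<noteq> 0" using nz by blast
  \<comment> \<open>\<open>P\<close> cannot kill the whole orbit of \<open>R x1\<close> under the
    plane. Moving \<open>V (L b)\<close> inside \<open>R\<close> shows the surviving vector to be in
    the range of the composed operator.\<close>
  then obtain b where "plane.P (V (L b) (R x1)) \<noteq> 0"
    using plane.P_nonvanishing[of "R x1"] by blast
  then have nz': "plane.P (R (V (L b) x1)) \<noteq> 0" by (simp add: comm orth_L)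
  show ?case
  proof (intro exI[of _ "\<lambda>x. plane.P (R x)"] conjI allI impI)
    show "\<exists>x. plane.P (R x) \<noteq> 0" using nz' by blast
    show "bounded_linear (\<lambda>x. plane.P (R x))"
      by (rule bounded_linear_compose[OF plane.bounded_linear_P R])
    fix b x
    assume b: "orth (p # ps) b"
    then have "\<omega> b (L z) = 0" for z by (simp add: p L_def \<omega>_simps)
    then have "V b (plane.P x) = plane.P (V b x)" for x
      by (intro plane.P_bounded_linear_commute unitary_bounded_linear[OF unitary_V] V_commute)
    then show "plane.P (R (V b x)) = V b (plane.P (R x))"
      using b comm by (simp add: p)
  next
    fix x y \<xi>
    \<comment> \<open>The coordinates of \<open>\<xi>\<close> in the new plane: \<open>L z\<close>
      is the component of \<open>\<xi>\<close> there, and \<open>a\<close> collects the components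
      in the older planes.\<close>
    define z where "z = Complex (\<omega> \<xi> f) (- \<omega> \<xi> e)"
    define a where "a = proj ps \<xi>"
    have "\<omega> a (L z) = 0" using orth_proj[OF orth_L] antisym[of a] by (simp add: a_def)
    moreover have "proj (p # ps) \<xi> = a + L z" by (simp add: p a_def L_def z_def)
    ultimately have V: "V (proj (p # ps) \<xi>) v = V a (V (L z) v)" for v
      using V_orthogonal by simp
    \<comment> \<open>With the mean and \<open>V (L z)\<close> moved inside \<open>R\<close>, the
      induction hypothesis removes \<open>V a\<close>; the vacuum identity of the plane then removes
      \<open>V (L z)\<close>.\<close>
    have "cinner (plane.P (R y)) (V (proj (p # ps) \<xi>) (plane.P (R x))) =
        cinner (R (plane.P y)) (V a (R (V (L z) (plane.P x))))"
      by (simp add: V RP comm orth_L)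
    also have "\<dots> = exp (- energy ps \<xi> / 4) * cinner (R (plane.P y)) (R (V (L z) (plane.P x)))"
      unfolding a_def by (rule vac)
    also have "cinner (R (plane.P y)) (R (V (L z) (plane.P x))) =
        gauss z * cinner (plane.P (R y)) (plane.P (R x))"
      using plane.vacuum[of "R y" z "R x"] by (simp add: RP comm orth_L)
    also have "exp (- energy ps \<xi> / 4) * (gauss z * cinner (plane.P (R y)) (plane.P (R x))) =
        exp (- energy (p # ps) \<xi> / 4) * cinner (plane.P (R y)) (plane.P (R x))"
    proof -
      have "exp (- energy ps \<xi> / 4) * gauss z = exp (- energy (p # ps) \<xi> / 4)"
        by (simp add: p z_def gauss_def cmod_power2 exp_add[symmetric] add_divide_distrib[symmetric] add.commute)
      then show ?thesis by (metis mult.assoc of_real_mult)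
    qed
    finally show "cinner (plane.P (R y)) (V (proj (p # ps) \<xi>) (plane.P (R x))) =
        exp (- energy (p # ps) \<xi> / 4) * cinner (plane.P (R y)) (plane.P (R x))" .
  qed
qed

lemma vacuum_vector:
  assumes "darboux ps" "\<And>\<xi>. proj ps \<xi> = \<xi>" "(x0 :: 'h) \<noteq> 0"
  obtains v where "norm v = 1" "\<And>\<xi>. cinner v (V \<xi> v) = exp (- energy ps \<xi> / 4)"
proof -
  obtain u where u: "u \<noteq> 0" "\<And>\<xi>. cinner u (V \<xi> u) = exp (- energy ps \<xi> / 4) * cinner u u"
    using vacuum_operator[OF assms(1,3)] unfolding assms(2) by blast
  define v where "v = complex_of_real (1 / norm u) *\<^sub>C u"
  have "norm v = 1" using u(1) by (simp add: v_def norm_scaleC norm_divide del: of_real_divide)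
  moreover have "cinner v (V \<xi> v) = exp (- energy ps \<xi> / 4)" for \<xi>
    using u by (simp add: v_def unitary_scaleC[OF unitary_V] cinner_scaleC_left cinner_scaleC_right
        cinner_self power2_eq_square del: scaleC_of_real)
  ultimately show ?thesis using that by blast
qed

end

subsection \<open>Intertwiners\<close>

lemma unitary_phase:
  assumes "unitary (U :: 'h::complex_hilbert \<Rightarrow> 'h)" "cmod c = 1"
  shows "unitary (\<lambda>x. c *\<^sub>C U x)"
  unfolding unitary_def
proof (intro conjI allI)
  have c: "cnj c * c = 1" "c * cnj c = 1" using assms(2) complex_norm_square[of c] by (simp_all add: mult.commute)
  show "clinear (\<lambda>x. c *\<^sub>C U x)"
    unfolding Vector_Spaces.linear_iff
    by (intro conjI allI vector_space_scaleC)
      (simp_all add: unitary_add[OF assms(1)] unitary_scaleC[OF assms(1)] scaleC_add_right scaleC_scaleC mult.commute)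
  have "bij (\<lambda>x :: 'h. c *\<^sub>C x)"
    by (rule o_bij[of "\<lambda>x. cnj c *\<^sub>C x"]) (simp_all add: fun_eq_iff scaleC_scaleC c)
  from bij_comp[OF unitary_bij[OF assms(1)] this] show "bij (\<lambda>x. c *\<^sub>C U x)"
    by (simp add: o_def)
  show "cinner (c *\<^sub>C U x) (c *\<^sub>C U y) = cinner x y" for x y
    by (simp add: cinner_scaleC_left cinner_scaleC_right unitary_cinner[OF assms(1)] mult.assoc[symmetric] c)
qed

text \<open>A subbasic open set is a preimage under a linear functional \<open>f\<close>, and
  \<open>f \<circ> L\<close> is a linear functional on a Euclidean space, hence continuous.\<close>

lemma continuous_map_linear_topology:
  fixes L :: "'a::euclidean_space \<Rightarrow> 'w::real_vector"
  assumes "linear L"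
  shows "continuous_map euclidean linear_topology L"
  unfolding linear_topology_def continuous_on_generated_topo_iff
proof (intro conjI allI impI)
  fix U :: "'w set"
  assume "U \<in> {f -` U | (f :: 'w \<Rightarrow> real) U. linear f \<and> open U}"
  then obtain f :: "'w \<Rightarrow> real" and S where U: "U = f -` S" "linear f" "open S" by blast
  have "continuous_on UNIV (f \<circ> L)"
    using linear_compose[OF assms U(2)] linear_conv_bounded_linear linear_continuous_on by blast
  then have "open ((f \<circ> L) -` S)" by (rule open_vimage[OF U(3)])
  then show "openin euclidean (L -` U \<inter> topspace euclidean)"
    by (simp add: U(1) vimage_comp)
next
  have "linear (\<lambda>_::'w. 0::real)" by (rule linear_zero)
  then have "UNIV \<in> {f -` U | (f :: 'w \<Rightarrow> real) U. linear f \<and> open U}"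
    by (intro CollectI exI[of _ "\<lambda>_. 0"] exI[of _ UNIV]) auto
  then show "L ` topspace euclidean \<subseteq> \<Union> {f -` U | (f :: 'w \<Rightarrow> real) U. linear f \<and> open U}"
    by (rule subset_trans[OF subset_UNIV Union_upper])
qed

text \<open>Isometry turns a convergent sequence of the domain into a Cauchy sequence of partners,
  so the domain is a closed invariant subspace. A relation in place of a map lets the same argument
  serve the intertwiner and its inverse.\<close>

lemma closed_isometric_relation_domain:
  fixes G :: "('g::complex_hilbert \<times> 'h::complex_hilbert) set"
  assumes G: "closed G"
    and add: "\<And>x y x' y'. (x, y) \<in> G \<Longrightarrow> (x', y') \<in> G \<Longrightarrow> (x + x', y + y') \<in> G"
    and scale: "\<And>c x y. (x, y) \<in> G \<Longrightarrow> (c *\<^sub>C x, c *\<^sub>C y) \<in> G"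
    and norm: "\<And>x y. (x, y) \<in> G \<Longrightarrow> norm x = norm y"
    and W: "\<And>\<xi> x y. (x, y) \<in> G \<Longrightarrow> (W \<xi> x, W' \<xi> y) \<in> G"
    and irr: "irreducible_representation W"
    and nz: "(x0, y0) \<in> G" "x0 \<noteq> 0"
  shows "\<exists>y. (x, y) \<in> G"
proof -
  define D where "D = {x. \<exists>y. (x, y) \<in> G}"
  have "closed D"
    unfolding closed_sequential_limits
  proof (intro allI impI, elim conjE)
    fix X x
    assume "\<forall>n. X n \<in> D" and X: "X \<longlonglongrightarrow> x"
    then obtain Y where Y: "\<And>n. (X n, Y n) \<in> G" using choice[of "\<lambda>n y. (X n, y) \<in> G"] by (auto simp: D_def)
    have "norm (Y m - Y n) = norm (X m - X n)" for m n
      using norm[OF add[OF Y[of m] scale[OF Y[of n], of "- 1"]]] by (simp add: scaleC_diff_minus)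
    then have "Cauchy Y"
      using LIMSEQ_imp_Cauchy[OF X] by (simp add: Cauchy_def dist_norm)
    then obtain y where "Y \<longlonglongrightarrow> y" using Cauchy_convergent convergent_def by blast
    then have "(\<lambda>n. (X n, Y n)) \<longlonglongrightarrow> (x, y)" using X by (intro tendsto_Pair)
    then have "(x, y) \<in> G" by (rule closed_sequentially[OF G Y])
    then show "x \<in> D" unfolding D_def by blast
  qed
  moreover have "csubspace D"
  proof -
    have mod: "module (scaleC :: complex \<Rightarrow> 'g \<Rightarrow> 'g)"
      using vector_space_scaleC by (simp add: module_iff_vector_space)
    have "(0, 0) \<in> G" using scale[OF nz(1), of 0] by simp
    then show ?thesis
      unfolding module.subspace_def[OF mod] D_def using add scale by blast
  qed
  moreover have "W \<xi> ` D \<subseteq> D" for \<xi> unfolding D_def using W by blast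
  moreover have "D \<noteq> {0}" using nz unfolding D_def by blast
  ultimately have "D = UNIV" using irr unfolding irreducible_representation_def by blast
  then show ?thesis unfolding D_def by blast
qed

text \<open>The graph of the intertwiner, restricted to the span of the orbit of the cyclic vector.\<close>

inductive orbit_graph :: "('w \<Rightarrow> 'g::complex_hilbert \<Rightarrow> 'g) \<Rightarrow> ('w \<Rightarrow> 'h::complex_hilbert \<Rightarrow> 'h) \<Rightarrow> 'g \<Rightarrow> 'h \<Rightarrow> 'g \<Rightarrow> 'h \<Rightarrow> bool"
  for W W' v v' where
    base: "orbit_graph W W' v v' v v'"
  | add: "orbit_graph W W' v v' x y \<Longrightarrow> orbit_graph W W' v v' x' y' \<Longrightarrow> orbit_graph W W' v v' (x + x') (y + y')"
  | scale: "orbit_graph W W' v v' x y \<Longrightarrow> orbit_graph W W' v v' (c *\<^sub>C x) (c *\<^sub>C y)"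
  | act: "orbit_graph W W' v v' x y \<Longrightarrow> orbit_graph W W' v v' (W \<xi> x) (W' \<xi> y)"

text \<open>Uniqueness in the GNS construction. Equal coefficients make the correspondence of the
  orbits of \<open>v\<close> and \<open>v'\<close> isometric; irreducibility of either side makes
  the closure of its graph total and onto, and isometry makes it single valued and
  injective.\<close>

lemma unitarily_equivalent_if_same_coefficients:
  fixes W :: "'w::ab_group_add \<Rightarrow> 'g::complex_hilbert \<Rightarrow> 'g" and W' :: "'w \<Rightarrow> 'h::complex_hilbert \<Rightarrow> 'h"
    and c :: "'w \<Rightarrow> 'w \<Rightarrow> complex"
  assumes uni: "\<And>\<xi>. unitary (W \<xi>)" "\<And>\<xi>. unitary (W' \<xi>)"
    and mult: "\<And>\<xi> \<eta> x. W \<xi> (W \<eta> x) = c \<xi> \<eta> *\<^sub>C W (\<xi> + \<eta>) x"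
      "\<And>\<xi> \<eta> x. W' \<xi> (W' \<eta> x) = c \<xi> \<eta> *\<^sub>C W' (\<xi> + \<eta>) x"
    and c: "\<And>\<xi> \<eta>. c \<xi> \<eta> \<noteq> 0" "c 0 0 = 1"
    and irr: "irreducible_representation W" "irreducible_representation W'"
    and coeff: "\<And>\<xi>. cinner v (W \<xi> v) = cinner v' (W' \<xi> v')"
    and nz: "v \<noteq> 0" "v' \<noteq> 0"
  shows "unitarily_equivalent W W'"
proof -
  let ?G = "orbit_graph W W' v v'"
  note bl = unitary_bounded_linear[OF uni(1)] unitary_bounded_linear[OF uni(2)]
  have W0: "W 0 x = x" for x
    using mult(1)[of 0 0 x] unitary_bij[OF uni(1), of 0] by (metis add_0 bij_pointE c(2) scaleC_one)
  have W'0: "W' 0 x = x" for x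
    using mult(2)[of 0 0 x] unitary_bij[OF uni(2), of 0] by (metis add_0 bij_pointE c(2) scaleC_one)
  have left: "cinner v (W \<xi> x) = cinner v' (W' \<xi> y)" if "?G x y" for x y \<xi>
    using that
  proof (induction arbitrary: \<xi>)
    case base
    show ?case by (rule coeff)
  qed (simp_all add: unitary_add[OF uni(1)] unitary_add[OF uni(2)] unitary_scaleC[OF uni(1)]
      unitary_scaleC[OF uni(2)] cinner_add_right cinner_scaleC_right mult)
  have iso0: "cinner x x' = cinner y y'" if "?G x y" "?G x' y'" for x y x' y'
    using that
  proof (induction arbitrary: x' y')
    case base
    then show ?case using left[of x' y' 0] by (simp add: W0 W'0)
  next
    case (act x y \<xi>)
    \<comment> \<open>Up to the scalar \<open>c \<xi> (- \<xi>)\<close>, the inverse of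
      \<open>W \<xi>\<close> is \<open>W (- \<xi>)\<close>, and likewise for \<open>W'\<close>.
      Moving it to the other argument keeps that pair in the graph, where the induction hypothesis
      applies.\<close>
    let ?d = "inverse (c \<xi> (- \<xi>))"
    have "x' = W \<xi> (?d *\<^sub>C W (- \<xi>) x')" "y' = W' \<xi> (?d *\<^sub>C W' (- \<xi>) y')"
      by (simp_all add: unitary_scaleC[OF uni(1)] unitary_scaleC[OF uni(2)] mult scaleC_scaleC c W0 W'0)
    then have "cinner (W \<xi> x) x' = cinner x (?d *\<^sub>C W (- \<xi>) x')"
      "cinner (W' \<xi> y) y' = cinner y (?d *\<^sub>C W' (- \<xi>) y')"
      by (metis unitary_cinner uni(1), metis unitary_cinner uni(2))
    then show ?case
      using act.IH act.prems by (simp add: orbit_graph.scale orbit_graph.act)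
  qed (simp_all add: cinner_add_left cinner_scaleC_left)
  define G where "G = closure {(x, y). ?G x y}"
  have seq: "(x, y) \<in> G \<longleftrightarrow> (\<exists>X Y. (\<forall>n. ?G (X n) (Y n)) \<and> X \<longlonglongrightarrow> x \<and> Y \<longlonglongrightarrow> y)" for x y
  proof
    assume "(x, y) \<in> G"
    then obtain Z where Z: "\<And>n. Z n \<in> {(x, y). ?G x y}" "Z \<longlonglongrightarrow> (x, y)"
      unfolding G_def closure_sequential by blast
    then show "\<exists>X Y. (\<forall>n. ?G (X n) (Y n)) \<and> X \<longlonglongrightarrow> x \<and> Y \<longlonglongrightarrow> y"
      using tendsto_fst[OF Z(2)] tendsto_snd[OF Z(2)]
      by (intro exI[of _ "\<lambda>n. fst (Z n)"] exI[of _ "\<lambda>n. snd (Z n)"]) (auto simp: case_prod_beta)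
  next
    assume "\<exists>X Y. (\<forall>n. ?G (X n) (Y n)) \<and> X \<longlonglongrightarrow> x \<and> Y \<longlonglongrightarrow> y"
    then obtain X Y where "\<And>n. ?G (X n) (Y n)" "X \<longlonglongrightarrow> x" "Y \<longlonglongrightarrow> y" by blast
    then show "(x, y) \<in> G"
      unfolding G_def closure_sequential by (intro exI[of _ "\<lambda>n. (X n, Y n)"]) (auto intro: tendsto_Pair)
  qed
  have closed: "closed G" unfolding G_def by simp
  have v: "(v, v') \<in> G"
    unfolding G_def by (rule subsetD[OF closure_subset]) (simp add: base)
  have add: "(x + x', y + y') \<in> G" if xy: "(x, y) \<in> G" "(x', y') \<in> G" for x y x' y'
  proof -
    obtain X Y X' Y' where "\<forall>n. ?G (X n) (Y n)" "X \<longlonglongrightarrow> x" "Y \<longlonglongrightarrow> y"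
      "\<forall>n. ?G (X' n) (Y' n)" "X' \<longlonglongrightarrow> x'" "Y' \<longlonglongrightarrow> y'"
      using xy unfolding seq by blast
    then show ?thesis unfolding seq
      by (intro exI[of _ "\<lambda>n. X n + X' n"] exI[of _ "\<lambda>n. Y n + Y' n"]) (auto intro: tendsto_add orbit_graph.add)
  qed
  have scale: "(a *\<^sub>C x, a *\<^sub>C y) \<in> G" if xy: "(x, y) \<in> G" for a x y
  proof -
    obtain X Y where "\<forall>n. ?G (X n) (Y n)" "X \<longlonglongrightarrow> x" "Y \<longlonglongrightarrow> y"
      using xy unfolding seq by blast
    then show ?thesis unfolding seq
      by (intro exI[of _ "\<lambda>n. a *\<^sub>C X n"] exI[of _ "\<lambda>n. a *\<^sub>C Y n"])
        (auto intro: orbit_graph.scale bounded_bilinear.tendsto[OF bounded_bilinear_scaleC])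
  qed
  have act: "(W \<xi> x, W' \<xi> y) \<in> G" if xy: "(x, y) \<in> G" for \<xi> x y
  proof -
    obtain X Y where "\<forall>n. ?G (X n) (Y n)" "X \<longlonglongrightarrow> x" "Y \<longlonglongrightarrow> y"
      using xy unfolding seq by blast
    then show ?thesis unfolding seq
      by (intro exI[of _ "\<lambda>n. W \<xi> (X n)"] exI[of _ "\<lambda>n. W' \<xi> (Y n)"])
        (auto intro: orbit_graph.act bounded_linear.tendsto[OF bl(1)] bounded_linear.tendsto[OF bl(2)])
  qed
  have iso: "cinner x x' = cinner y y'" if xy: "(x, y) \<in> G" "(x', y') \<in> G" for x y x' y'
  proof -
    obtain X Y X' Y' where lim: "\<And>n. ?G (X n) (Y n)" "X \<longlonglongrightarrow> x" "Y \<longlonglongrightarrow> y"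
      "\<And>n. ?G (X' n) (Y' n)" "X' \<longlonglongrightarrow> x'" "Y' \<longlonglongrightarrow> y'"
      using xy unfolding seq by blast
    have "(\<lambda>n. cinner (X n) (X' n)) \<longlonglongrightarrow> cinner x x'"
      by (intro bounded_bilinear.tendsto[OF bounded_bilinear_cinner] lim)
    moreover have "(\<lambda>n. cinner (Y n) (Y' n)) \<longlonglongrightarrow> cinner y y'"
      by (intro bounded_bilinear.tendsto[OF bounded_bilinear_cinner] lim)
    ultimately show ?thesis
      using iso0[OF lim(1,4)] by (simp add: LIMSEQ_unique)
  qed
  have norm: "norm x = norm y" if "(x, y) \<in> G" for x y
    using iso[OF that that] unfolding cinner_self by (simp add: power2_eq_iff_nonneg del: of_real_power)
  have "\<exists>y. (x, y) \<in> G" for x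
    by (rule closed_isometric_relation_domain[OF closed add scale norm act irr(1) v nz(1)])
  then obtain U where U: "\<And>x. (x, U x) \<in> G" by metis
  have unique: "y = y'" if "(x, y) \<in> G" "(x, y') \<in> G" for x y y'
    using norm[OF add[OF that(1) scale[OF that(2), of "- 1"]]] by (simp add: scaleC_diff_minus[symmetric])
  have inj: "x = x'" if "(x, y) \<in> G" "(x', y) \<in> G" for x x' y
    using norm[OF add[OF that(1) scale[OF that(2), of "- 1"]]] by (simp add: scaleC_diff_minus[symmetric])
  have surj: "\<exists>x. (x, y) \<in> G" for y
  proof -
    have "closed (prod.swap -` G)"
      by (intro closed_vimage closed continuous_intros)
    have "\<exists>x. (y, x) \<in> prod.swap -` G"
    proof (rule closed_isometric_relation_domain[where W = W' and W' = W])
      show "closed (prod.swap -` G)" by fact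
      show "norm x = norm y" if "(x, y) \<in> prod.swap -` G" for x y
        using norm[of y x] that by simp
      show "(v', v) \<in> prod.swap -` G" using v by simp
    qed (simp_all add: add scale act irr(2) nz(2))
    then show ?thesis by auto
  qed
  have "unitary U"
    unfolding unitary_def
  proof (intro conjI allI)
    show "clinear U"
      unfolding Vector_Spaces.linear_iff
      by (intro conjI allI vector_space_scaleC unique[OF U add[OF U U]] unique[OF U scale[OF U]])
    have "inj U" by (rule injI) (metis inj U)
    moreover have "\<exists>x. y = U x" for y using surj[of y] unique[OF U] by blast
    ultimately show "bij U" by (simp add: bij_def surj_def)
    show "cinner (U x) (U y) = cinner x y" for x y
      using iso[OF U U] by simp
  qed
  moreover have "U (W \<xi> x) = W' \<xi> (U x)" for \<xi> x
    by (rule unique[OF U act[OF U]])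
  ultimately show ?thesis unfolding unitarily_equivalent_def by blast
qed

section \<open>From twisted representations to Weyl systems\<close>

lemma vacuum_of_twisted_representation:
  fixes \<sigma> :: "'w::real_vector \<Rightarrow> 'w \<Rightarrow> real" and T :: "'w \<Rightarrow> 'w"
    and W :: "'w \<Rightarrow> 'h::complex_hilbert \<Rightarrow> 'h"
  defines "\<omega> \<equiv> \<lambda>\<xi> \<eta>. \<sigma> \<xi> (T \<eta>) - \<sigma> \<eta> (T \<xi>)"
  assumes \<sigma>: "bilinear \<sigma>" and T: "linear T"
    and W: "twisted_representation \<sigma> T W" and nontrivial: "(UNIV :: 'h set) \<noteq> {0}"
    and ps: "antisymmetric_form.darboux \<omega> ps" "\<And>\<xi>. antisymmetric_form.proj \<omega> ps \<xi> = \<xi>"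
  shows "\<exists>v. norm v = 1 \<and> (\<forall>\<xi>. cinner v (W \<xi> v) =
    cis (- \<sigma> \<xi> (T \<xi>) / 2) * exp (- antisymmetric_form.energy \<omega> ps \<xi> / 4))"
proof -
  let ?B = "\<lambda>\<xi> \<eta>. \<sigma> \<xi> (T \<eta>)"
  have B: "bilinear ?B"
    using \<sigma> T unfolding bilinear_def by (auto intro: linear_compose[of T, unfolded o_def])
  note B_simps = bilinear_ladd[OF B] bilinear_radd[OF B]
  have unitary: "unitary (W \<xi>)" and cont: "continuous_map linear_topology euclidean (\<lambda>\<xi>. W \<xi> x)"
    and mult: "W \<xi> (W \<eta> x) = cis (?B \<xi> \<eta>) *\<^sub>C W (\<xi> + \<eta>) x" for \<xi> \<eta> x
    using W unfolding twisted_representation_def twist_def cis_conv_exp by blast+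
  define V where "V \<xi> x = cis (?B \<xi> \<xi> / 2) *\<^sub>C W \<xi> x" for \<xi> x
  interpret weyl_system \<omega> V
  proof
    show "bilinear \<omega>"
      using B unfolding bilinear_def \<omega>_def by (auto intro: linear_compose_sub)
    show "\<omega> \<xi> \<eta> = - \<omega> \<eta> \<xi>" for \<xi> \<eta> by (simp add: \<omega>_def)
    show "unitary (V \<xi>)" for \<xi>
      unfolding V_def by (intro unitary_phase unitary) simp
    show "V \<xi> (V \<eta> x) = cis (\<omega> \<xi> \<eta> / 2) *\<^sub>C V (\<xi> + \<eta>) x" for \<xi> \<eta> x
    proof -
      \<comment> \<open>The cocycle \<open>?B\<close> differs from \<open>\<omega> / 2\<close> by
        the coboundary of half its diagonal, which the phase in \<open>V\<close> cancels.\<close>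
      have "?B \<xi> \<xi> / 2 + (?B \<eta> \<eta> / 2 + ?B \<xi> \<eta>) = \<omega> \<xi> \<eta> / 2 + ?B (\<xi> + \<eta>) (\<xi> + \<eta>) / 2"
        unfolding \<omega>_def B_simps by (simp add: field_simps)
      then show ?thesis
        by (simp only: V_def unitary_scaleC[OF unitary] mult scaleC_scaleC cis_mult add.assoc)
    qed
    show "continuous_on UNIV (\<lambda>z. V (Re z *\<^sub>R e + Im z *\<^sub>R f) x)" for e f x
    proof -
      let ?L = "\<lambda>z. Re z *\<^sub>R e + Im z *\<^sub>R f"
      have L: "linear ?L" by (rule linearI) (simp_all add: algebra_simps)
      have "continuous_map euclidean euclidean ((\<lambda>\<xi>. W \<xi> x) \<circ> ?L)"
        by (rule continuous_map_compose[OF continuous_map_linear_topology[OF L] cont])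
      then have W: "continuous_on UNIV (\<lambda>z. W (?L z) x)" by (simp add: o_def)
      \<comment> \<open>Along a plane the exponent of the phase is a quadratic polynomial in the
        coordinates, hence continuous.\<close>
      have "?B (?L z) (?L z) = (Re z)\<^sup>2 * ?B e e + Re z * Im z * (?B e f + ?B f e) + (Im z)\<^sup>2 * ?B f f" for z
        by (simp only: bilinear_ladd[OF B] bilinear_radd[OF B] bilinear_lmul[OF B] bilinear_rmul[OF B])
          (simp add: algebra_simps power2_eq_square)
      then have "continuous_on UNIV (\<lambda>z. ?B (?L z) (?L z))"
        by (simp only:) (intro continuous_intros)
      then show ?thesis
        unfolding V_def cis_conv_exp
        by (intro bounded_bilinear.continuous_on[OF bounded_bilinear_scaleC] W continuous_intros) auto
    qed
  qed
  obtain x0 :: 'h where x0: "x0 \<noteq> 0" using nontrivial by auto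
  obtain v where v: "norm v = 1" "\<And>\<xi>. cinner v (V \<xi> v) = exp (- energy ps \<xi> / 4)"
    by (rule vacuum_vector[OF ps x0]) blast
  have "cinner v (W \<xi> v) = cis (- ?B \<xi> \<xi> / 2) * exp (- energy ps \<xi> / 4)" for \<xi>
  proof -
    have "W \<xi> v = cis (- ?B \<xi> \<xi> / 2) *\<^sub>C V \<xi> v"
      by (simp add: V_def scaleC_scaleC cis_mult)
    then show ?thesis by (simp add: cinner_scaleC_right v)
  qed
  then show ?thesis using v(1) by blast
qed

theorem corollary3p5:
  fixes \<sigma> :: "'w::real_vector \<Rightarrow> 'w \<Rightarrow> real"
    and T :: "'w \<Rightarrow> 'w"
    and W\<^sub>1 :: "'w \<Rightarrow> 'g::complex_hilbert \<Rightarrow> 'g"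
    and W\<^sub>2 :: "'w \<Rightarrow> 'h::complex_hilbert \<Rightarrow> 'h"
  assumes "symplectic \<sigma>"
    and "linear T"
    and "bij (\<lambda>\<xi>. T \<xi> + symplectic_adjoint \<sigma> T \<xi>)"
    and "twisted_representation \<sigma> T W\<^sub>1" and "irreducible_representation W\<^sub>1"
    and "twisted_representation \<sigma> T W\<^sub>2" and "irreducible_representation W\<^sub>2"
  shows "unitarily_equivalent W\<^sub>1 W\<^sub>2"
proof -
  obtain B :: "'w set" where B: "finite B" "span B = UNIV"
    using assms(1) unfolding symplectic_def by blast
  note symp = assms(1)[unfolded symplectic_def, THEN conjunct2]
  have \<sigma>: "bilinear \<sigma>" by (rule conjunct1[OF symp])
  have anti: "\<sigma> \<xi> \<eta> = - \<sigma> \<eta> \<xi>" for \<xi> \<eta>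
    by (rule symp[THEN conjunct2, THEN conjunct1, rule_format])
  have nondeg: "\<xi> = 0" if "\<And>\<eta>. \<sigma> \<xi> \<eta> = 0" for \<xi>
    using that by (intro symp[THEN conjunct2, THEN conjunct2, rule_format])
  let ?S = "symplectic_adjoint \<sigma> T"
  have S: "\<sigma> (?S \<xi>) \<eta> = \<sigma> \<xi> (T \<eta>)" for \<xi> \<eta>
    by (rule symplectic_adjoint_works[OF assms(1,2)])
  define \<omega> where "\<omega> = (\<lambda>\<xi> \<eta>. \<sigma> \<xi> (T \<eta>) - \<sigma> \<eta> (T \<xi>))"
  have \<omega>: "\<omega> \<xi> \<eta> = \<sigma> (T \<xi> + ?S \<xi>) \<eta>" for \<xi> \<eta>
    using anti[of \<eta> "T \<xi>"] by (simp add: \<omega>_def S bilinear_ladd[OF \<sigma>])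
  have \<omega>_nondeg: "\<xi> = 0" if "\<And>\<eta>. \<omega> \<xi> \<eta> = 0" for \<xi>
  proof -
    \<comment> \<open>The bijection sends both \<open>\<xi>\<close> and 0 to 0, so its injectivity
      gives the claim.\<close>
    have "T \<xi> + ?S \<xi> = 0" using that by (intro nondeg) (simp add: \<omega>)
    moreover have "?S 0 = 0" by (rule nondeg) (simp add: S bilinear_lzero[OF \<sigma>])
    ultimately have "T \<xi> + ?S \<xi> = T 0 + ?S 0" using linear_0[OF assms(2)] by simp
    then show "\<xi> = 0" by (rule injD[OF bij_is_inj[OF assms(3)]])
  qed
  interpret antisymmetric_form \<omega>
  proof
    have "bilinear (\<lambda>\<xi> \<eta>. \<sigma> \<xi> (T \<eta>))"
      using \<sigma> assms(2) unfolding bilinear_def by (auto intro: linear_compose[of T, unfolded o_def])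
    then show "bilinear \<omega>" unfolding bilinear_def \<omega>_def by (auto intro: linear_compose_sub)
    show "\<omega> \<xi> \<eta> = - \<omega> \<eta> \<xi>" for \<xi> \<eta> by (simp add: \<omega>_def)
  qed
  obtain ps where ps: "darboux ps" "\<And>\<xi>. proj ps \<xi> = \<xi>"
    using darboux_basis[OF \<omega>_nondeg B] by blast
  note nontrivial = assms(5,7)[unfolded irreducible_representation_def, THEN conjunct1]
  \<comment> \<open>This function involves only \<open>\<sigma>\<close>, \<open>T\<close> and the
    Darboux basis, so the vacua of both representations share it.\<close>
  let ?\<phi> = "\<lambda>\<xi>. cis (- \<sigma> \<xi> (T \<xi>) / 2) * exp (- energy ps \<xi> / 4)"
  obtain v\<^sub>1 where v\<^sub>1: "norm v\<^sub>1 = 1" "\<And>\<xi>. cinner v\<^sub>1 (W\<^sub>1 \<xi> v\<^sub>1) = ?\<phi> \<xi>"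
    using vacuum_of_twisted_representation[OF \<sigma> assms(2,4) nontrivial(1), folded \<omega>_def, OF ps] by blast
  obtain v\<^sub>2 where v\<^sub>2: "norm v\<^sub>2 = 1" "\<And>\<xi>. cinner v\<^sub>2 (W\<^sub>2 \<xi> v\<^sub>2) = ?\<phi> \<xi>"
    using vacuum_of_twisted_representation[OF \<sigma> assms(2,6) nontrivial(2), folded \<omega>_def, OF ps] by blast
  have rep\<^sub>1: "unitary (W\<^sub>1 \<xi>)" "W\<^sub>1 \<xi> (W\<^sub>1 \<eta> x) = twist \<sigma> T \<xi> \<eta> *\<^sub>C W\<^sub>1 (\<xi> + \<eta>) x"
    and rep\<^sub>2: "unitary (W\<^sub>2 \<xi>)" "W\<^sub>2 \<xi> (W\<^sub>2 \<eta> y) = twist \<sigma> T \<xi> \<eta> *\<^sub>C W\<^sub>2 (\<xi> + \<eta>) y" for \<xi> \<eta> x y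
    using assms(4,6) unfolding twisted_representation_def by simp_all
  show ?thesis
  proof (rule unitarily_equivalent_if_same_coefficients[where c = "twist \<sigma> T"])
    show "cinner v\<^sub>1 (W\<^sub>1 \<xi> v\<^sub>1) = cinner v\<^sub>2 (W\<^sub>2 \<xi> v\<^sub>2)" for \<xi>
      by (simp only: v\<^sub>1 v\<^sub>2)
    show "v\<^sub>1 \<noteq> 0" "v\<^sub>2 \<noteq> 0" using v\<^sub>1(1) v\<^sub>2(1) by auto
    show "twist \<sigma> T 0 0 = 1" by (simp add: twist_def bilinear_lzero[OF \<sigma>])
    show "twist \<sigma> T \<xi> \<eta> \<noteq> 0" for \<xi> \<eta> by (simp add: twist_def)
  qed (rule rep\<^sub>1(1) rep\<^sub>2(1) rep\<^sub>1(2) rep\<^sub>2(2) assms(5,7))+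
qed

end
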